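(* Let $T=T_s$, $s\in(\sqrt2,2]$, be a tent map with kneading sequence $\nu=10(c_3\ldots c_{n+2})^\infty$ such that $\#_1(c_3\ldots c_{n+2})$ is odd and $c_{n+2}=1$, and let $X'$ be the core of its inverse limit. Assume that $c_{n+1}=0$ and that the tail $(10c_3\ldots c_n)^\infty$ is admissible. Then for every folding point $p\in X'$ there exists an admissible left-infinite sequence $L$ such that $p$ is of Type 3 in $\varphi_L(X')$.
   Context: Tent inverse limits. For $s\in(\sqrt2,2]$ let $T=T_s\colon[0,1]\to[0,1]$, $T_s(t)=\min\{st,s(1-t)\}$, $c=\frac12$, and $X=\{x=(\pi_i(x))_{i\le0}\in[0,1]^{-\mathbb N_0}: T(\pi_i(x))=\pi_{i+1}(x)\ \forall i<0\}$ with the product topology. The core is $X'=\varprojlim([T^2(c),T(c)],T)\subset X$; $X=X'\cup\mathcal C$, where $\mathcal C$ is a ray containing the fixed point $(\ldots,0,0)$. A folding point of $X'$ is a point having no neighbourhood homeomorphic to (Cantor set)$\times(0,1)$. Symbolics. $\#_1(w)$ is the number of ones of a word $w$. The kneading sequence is $\nu=c_1c_2\ldots$, $c_i=0$ if $T^i(c)\in[0,c]$, $c_i=1$ if $T^i(c)\in[c,1]$; if $T^n(c)=c$, $\nu$ is the smaller of $(c_1\ldots c_{n-1}0)^\infty,(c_1\ldots c_{n-1}1)^\infty$ in the parity-lexicographical order: for sequences (or words of equal length) first differing at index $k$, $s\prec t$ iff $s_k<t_k$ and $\#_1(s_1\ldots s_{k-1})$ is even, or $s_k>t_k$ and it is odd.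 A word $a_1\ldots a_n$ is admissible if $c_2\ldots c_{2+n-i}\preceq a_i\ldots a_n\preceq c_1\ldots c_{1+n-i}$ for all $i$. An infinite sequence is admissible if all its finite subwords are; additionally, sequences $0^\infty s_ks_{k+1}\ldots$ with $s_k=1$ and the part from $s_k$ on admissible (and the constant zero sequence) are called admissible; these correspond to points of $\mathcal C$. $X$ is identified with $\Sigma_{adm}/\!\sim$, where $\Sigma_{adm}$ is the set of admissible two-sided sequences $\ldots s_{-1}.s_0s_1\ldots$ and $s\sim t$ iff $s=t$ or they differ at exactly one index $k$ and $s_{k+1}s_{k+2}\ldots=t_{k+1}t_{k+2}\ldots=\nu$; the point $x$ corresponds to the class of $(x_i)$ with $x_i=0$ (resp. $1$) if $\pi_i(x)$ (for $i\le0$) or $T^i(\pi_0(x))$ (for $i>0$) lies in $[0,c]$ (resp. $[c,1]$). Using only sequences all of whose finite subwords are admissible gives $X'$. Left-infinite sequences are written $\overleftarrow s=\ldots s_2s_1$ ($s_j$ being the entry at index $-j$), and the basic arc $A(\overleftarrow s)$ is the set of points of $X$ having a representative with left part $\overleftarrow s$; it is an arc or a point. For $\nu$ as in the claim each folding point $p$ has a unique two-sided itinerary, with left part $\overleftarrow p$. Embeddings. For an admissible left-infinite $L=\ldots l_2l_1$, put $\overleftarrow s\prec_L\overleftarrow t$ iff, $k$ being the smallest index with $s_k\ne t_k$, either $t_k=l_k$ and $\#_1(s_{k-1}\ldots s_1)-\#_1(l_{k-1}\ldots l_1)$ is even, or $s_k=l_k$ and it is odd. Let $\psi_L(\overleftarrow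 s)=\sum_{i\ge1}(-1)^{\#_1(l_i\ldots l_1)-\#_1(s_i\ldots s_1)}3^{-i}+\frac12$. The embedding $\varphi_L\colon X\to\mathbb R^2$ draws each basic arc $A(\overleftarrow s)$ as the horizontal segment $\pi_0(A(\overleftarrow s))\times\{\psi_L(\overleftarrow s)\}$; whenever two $\sim$-identified two-sided sequences differ only at an index $k<0$, the corresponding endpoints of the two basic arcs are joined by a semicircle, on the left if $\#_1$ of the word at indices $k+1,\ldots,-1$ is odd and on the right if it is even. $X'$ is embedded by restricting $\varphi_L$. For an admissible word $a_n\ldots a_1$ the cylinder $[a_n\ldots a_1]$ is the set of admissible left-infinite sequences of $X'$ ending in $a_n\ldots a_1$; its extrema are its $\prec_L$-largest and $\prec_L$-smallest elements. Type 3. Let $\tau_L(\overleftarrow s)=\sup\{n>1: s_{n-1}\ldots s_1=c_1\ldots c_{n-1},\ \#_1(c_1\ldots c_{n-1})\text{ odd}\}$ and $\tau_R(\overleftarrow s)=\sup\{n\ge1: s_{n-1}\ldots s_1=c_1\ldots c_{n-1},\ \#_1(c_1\ldots c_{n-1})\text{ even}\}$ (the subscripts mean left and right). If finite, the right neighbour $\overleftarrow{r(s)}$ (left neighbour $\overleftarrow{l(s)}$) is obtained from $\overleftarrow s$ by changing only the entry at index $\tau_R(\overleftarrow s)$ (resp. $\tau_L(\overleftarrow s)$). A point $a$ of a plane continuum $K$ (here $\varphi_L(X')$) is accessible if some arc $A\subset\mathbb R^2$ has $A\cap K=\{a\}$. An accessible folding point $p$ is of Type 3 if none of $\overleftarrow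 p,\overleftarrow{r(p)},\overleftarrow{l(p)}$ is an extremum of any cylinder (in this case $p$ is the only accessible point of its arc-component). *)

theory Defs
  imports "HOL-Analysis.Analysis"
begin

section \<open>Tent inverse limits\<close>

definition tent :: "real \<Rightarrow> real \<Rightarrow> real" where
  "tent s t = min (s * t) (s * (1 - t))"

text \<open>A point \<open>x\<close> of the inverse limit is stored with its coordinates indexed by \<open>nat\<close>:
  \<open>x i\<close> is the projection \<open>\<pi>\<close> to the (nonpositive) index \<open>- i\<close>. The topology is the library's
  product topology on \<open>nat \<Rightarrow> real\<close>.\<close>

definition inv_limit :: "real \<Rightarrow> (nat \<Rightarrow> real) set" where
  "inv_limit s = {x. (\<forall>i. x i \<in> {0..1}) \<and> (\<forall>i. tent s (x (Suc i)) = x i)}"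

definition core :: "real \<Rightarrow> (nat \<Rightarrow> real) set" where
  "core s = {x \<in> inv_limit s. \<forall>i. x i \<in> {tent s (tent s (1/2))..tent s (1/2)}}"

definition cantor_set :: "real set" where
  "cantor_set = range (\<lambda>a :: nat \<Rightarrow> bool. \<Sum>i. (if a i then 2 else 0) / 3 ^ Suc i)"

definition folding_point :: "real \<Rightarrow> (nat \<Rightarrow> real) \<Rightarrow> bool" where
  "folding_point s p \<longleftrightarrow> p \<in> core s \<and>
     \<not> (\<exists>N U. openin (top_of_set (core s)) U \<and> p \<in> U \<and> U \<subseteq> N \<and> N \<subseteq> core s \<and>
            N homeomorphic (cantor_set \<times> {0<..<1::real}))"


section \<open>Symbolics\<close>

text \<open>The digit 1 is \<open>True\<close> and the digit 0 is \<open>False\<close>; words are lists of digits.\<close>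

definition ones :: "bool list \<Rightarrow> nat" where
  "ones w = count_list w True"

definition plex_less :: "bool list \<Rightarrow> bool list \<Rightarrow> bool" where
  "plex_less u v \<longleftrightarrow> length u = length v \<and>
     (\<exists>k<length u. take k u = take k v \<and>
        ((\<not> u ! k \<and> v ! k \<and> even (ones (take k u))) \<or>
         (u ! k \<and> \<not> v ! k \<and> odd (ones (take k u)))))"

definition plex_le :: "bool list \<Rightarrow> bool list \<Rightarrow> bool" where
  "plex_le u v \<longleftrightarrow> u = v \<or> plex_less u v"

definition plex_less_seq :: "(nat \<Rightarrow> bool) \<Rightarrow> (nat \<Rightarrow> bool) \<Rightarrow> bool" where
  "plex_less_seq a b \<longleftrightarrow> (\<exists>m. plex_less (map a [0..<m]) (map b [0..<m]))"

definition cycle_seq :: "bool list \<Rightarrow> nat \<Rightarrow> bool" where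
  "cycle_seq w i = w ! (i mod length w)"

text \<open>\<open>kneading s i\<close> is the entry \<open>c\<^sub>i\<close> for \<open>i \<ge> 1\<close>; the value at \<open>i = 0\<close> has no meaning
  and is never used. The digit \<open>crit_digit s i\<close> is determined by the position of the \<open>i\<close>-th
  iterate of the critical point unless that iterate is \<open>1/2\<close> itself.\<close>

definition crit_digit :: "real \<Rightarrow> nat \<Rightarrow> bool" where
  "crit_digit s i \<longleftrightarrow> 1/2 \<le> (tent s ^^ i) (1/2)"

definition kneading :: "real \<Rightarrow> nat \<Rightarrow> bool" where
  "kneading s i =
     (if \<exists>m\<ge>1. (tent s ^^ m) (1/2) = 1/2
      then let m = (LEAST m. 1 \<le> m \<and> (tent s ^^ m) (1/2) = 1/2);
               a = cycle_seq (map (crit_digit s) [1..<m] @ [False]);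
               b = cycle_seq (map (crit_digit s) [1..<m] @ [True])
           in (if plex_less_seq a b then a else b) (i - 1)
      else crit_digit s i)"

definition kneading_word :: "real \<Rightarrow> nat \<Rightarrow> nat \<Rightarrow> bool list" where
  "kneading_word s j m = map (kneading s) [j..<j + m]"

definition adm_word :: "real \<Rightarrow> bool list \<Rightarrow> bool" where
  "adm_word s a \<longleftrightarrow>
     (\<forall>i<length a. plex_le (kneading_word s 2 (length a - i)) (drop i a) \<and>
                   plex_le (drop i a) (kneading_word s 1 (length a - i)))"

text \<open>A left-infinite sequence \<open>\<dots> s\<^sub>2 s\<^sub>1\<close> is stored as a function on \<open>nat\<close> whose value at \<open>j\<close>
  is the entry \<open>s\<close> with subscript \<open>j + 1\<close> (which sits at index \<open>- (j + 1)\<close>).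
  Hence \<open>left_word u n\<close> is the word \<open>u\<^sub>n \<dots> u\<^sub>1\<close>.\<close>

definition left_word :: "(nat \<Rightarrow> bool) \<Rightarrow> nat \<Rightarrow> bool list" where
  "left_word u n = map u (rev [0..<n])"

definition left_adm_core :: "real \<Rightarrow> (nat \<Rightarrow> bool) \<Rightarrow> bool" where
  "left_adm_core s u \<longleftrightarrow> (\<forall>i j. adm_word s (map u (rev [i..<j])))"

text \<open>The last two disjuncts are the sequences that belong to the ray.\<close>

definition left_adm :: "real \<Rightarrow> (nat \<Rightarrow> bool) \<Rightarrow> bool" where
  "left_adm s u \<longleftrightarrow> left_adm_core s u \<or>
     (\<exists>k. u k \<and> (\<forall>j>k. \<not> u j) \<and> adm_word s (left_word u (Suc k))) \<or>
     (\<forall>j. \<not> u j)"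

definition left_cycle :: "bool list \<Rightarrow> nat \<Rightarrow> bool" where
  "left_cycle w = cycle_seq (rev w)"

definition two_sided_adm :: "real \<Rightarrow> (int \<Rightarrow> bool) \<Rightarrow> bool" where
  "two_sided_adm s t \<longleftrightarrow> (\<forall>i j. adm_word s (map t [i..j])) \<or>
     (\<exists>k. t k \<and> (\<forall>i<k. \<not> t i) \<and> (\<forall>i j. k \<le> i \<longrightarrow> adm_word s (map t [i..j]))) \<or>
     (\<forall>i. \<not> t i)"

text \<open>The two sequences differ at exactly the index \<open>k\<close> and continue after it with the
  kneading sequence.\<close>

definition identified_at :: "real \<Rightarrow> int \<Rightarrow> (int \<Rightarrow> bool) \<Rightarrow> (int \<Rightarrow> bool) \<Rightarrow> bool" where
  "identified_at s k t u \<longleftrightarrow> t k \<noteq> u k \<and> (\<forall>i. i \<noteq> k \<longrightarrow> t i = u i) \<and>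
     (\<forall>j::nat. 1 \<le> j \<longrightarrow> t (k + int j) = kneading s j)"

definition left_part :: "(int \<Rightarrow> bool) \<Rightarrow> nat \<Rightarrow> bool" where
  "left_part t j = t (- int (Suc j))"

definition coord :: "real \<Rightarrow> (nat \<Rightarrow> real) \<Rightarrow> int \<Rightarrow> real" where
  "coord s x i = (if i \<le> 0 then x (nat (- i)) else (tent s ^^ nat i) (x 0))"

text \<open>The representatives of \<open>x\<close>. Where a coordinate equals \<open>1/2\<close>, both digits are allowed,
  subject to admissibility of the whole sequence.\<close>

definition itinerary :: "real \<Rightarrow> (nat \<Rightarrow> real) \<Rightarrow> (int \<Rightarrow> bool) \<Rightarrow> bool" where
  "itinerary s x t \<longleftrightarrow> two_sided_adm s t \<and>
     (\<forall>i. coord s x i \<in> (if t i then {1/2..1} else {0..1/2}))"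


section \<open>The planar embeddings\<close>

definition left_less :: "(nat \<Rightarrow> bool) \<Rightarrow> (nat \<Rightarrow> bool) \<Rightarrow> (nat \<Rightarrow> bool) \<Rightarrow> bool" where
  "left_less L u v \<longleftrightarrow> (\<exists>k. (\<forall>j<k. u j = v j) \<and> u k \<noteq> v k \<and>
     ((v k = L k \<and> even (int (ones (left_word u k)) - int (ones (left_word L k)))) \<or>
      (u k = L k \<and> odd (int (ones (left_word u k)) - int (ones (left_word L k))))))"

definition psi :: "(nat \<Rightarrow> bool) \<Rightarrow> (nat \<Rightarrow> bool) \<Rightarrow> real" where
  "psi L u = (\<Sum>i. (-1) powi (int (ones (left_word L (Suc i))) - int (ones (left_word u (Suc i))))
                   / 3 ^ Suc i) + 1/2"

text \<open>The closed semicircle that joins \<open>(a, y)\<close> and \<open>(a, z)\<close>.\<close>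

definition semicircle :: "bool \<Rightarrow> real \<Rightarrow> real \<Rightarrow> real \<Rightarrow> (real \<times> real) set" where
  "semicircle on_left a y z =
     {q. dist q (a, (y + z) / 2) = \<bar>y - z\<bar> / 2 \<and> (if on_left then fst q \<le> a else a \<le> fst q)}"

text \<open>The part of the plane that \<open>\<phi>\<^sub>L\<close> draws for the point \<open>x\<close>. Over all \<open>x\<close>, the first set
  gives the horizontal segments (\<open>x\<close> lies in the basic arc of the left part of each of its
  itineraries). The second set gives the semicircles: a point with two itineraries that differ
  at a negative index is a common endpoint of two basic arcs, drawn in two places, and is
  represented by the whole semicircle that joins them. A point with a single itinerary, such as
  a folding point for the kneading sequences considered here, is drawn as a single point.\<close>

definition draw :: "real \<Rightarrow> (nat \<Rightarrow> bool) \<Rightarrow> (nat \<Rightarrow> real) \<Rightarrow> (real \<times> real) set" where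
  "draw s L x = {(x 0, psi L (left_part t)) | t. itinerary s x t} \<union>
     \<Union> {semicircle (odd (ones (map t [k + 1..-1]))) (x 0) (psi L (left_part t)) (psi L (left_part u))
         | t u k. k < 0 \<and> itinerary s x t \<and> itinerary s x u \<and> identified_at s k t u}"

definition core_image :: "real \<Rightarrow> (nat \<Rightarrow> bool) \<Rightarrow> (real \<times> real) set" where
  "core_image s L = (\<Union>x\<in>core s. draw s L x)"

definition accessible :: "(real \<times> real) set \<Rightarrow> real \<times> real \<Rightarrow> bool" where
  "accessible K a \<longleftrightarrow> (\<exists>g. arc g \<and> path_image g \<inter> K = {a})"


section \<open>Cylinders and Type 3\<close>

definition cylinder :: "real \<Rightarrow> bool list \<Rightarrow> (nat \<Rightarrow> bool) set" where
  "cylinder s w = {u. left_adm_core s u \<and> left_word u (length w) = w}"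

definition cylinder_extremum :: "real \<Rightarrow> (nat \<Rightarrow> bool) \<Rightarrow> (nat \<Rightarrow> bool) \<Rightarrow> bool" where
  "cylinder_extremum s L u \<longleftrightarrow> (\<exists>w. adm_word s w \<and> u \<in> cylinder s w \<and>
     ((\<forall>v\<in>cylinder s w. v = u \<or> left_less L v u) \<or>
      (\<forall>v\<in>cylinder s w. v = u \<or> left_less L u v)))"

definition tau_L :: "real \<Rightarrow> (nat \<Rightarrow> bool) \<Rightarrow> enat" where
  "tau_L s u = Sup {enat n | n. n > 1 \<and> left_word u (n - 1) = kneading_word s 1 (n - 1) \<and>
                                odd (ones (kneading_word s 1 (n - 1)))}"

definition tau_R :: "real \<Rightarrow> (nat \<Rightarrow> bool) \<Rightarrow> enat" where
  "tau_R s u = Sup {enat n | n. n \<ge> 1 \<and> left_word u (n - 1) = kneading_word s 1 (n - 1) \<and>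
                                even (ones (kneading_word s 1 (n - 1)))}"

text \<open>The sets of neighbours have at most one element; they are empty if the supremum is
  infinite, and (for \<open>tau_L\<close>, outside the core) if it is a supremum of the empty set.\<close>

definition right_nbr :: "real \<Rightarrow> (nat \<Rightarrow> bool) \<Rightarrow> (nat \<Rightarrow> bool) set" where
  "right_nbr s u = {u(n - 1 := \<not> u (n - 1)) | n. n \<ge> 1 \<and> tau_R s u = enat n}"

definition left_nbr :: "real \<Rightarrow> (nat \<Rightarrow> bool) \<Rightarrow> (nat \<Rightarrow> bool) set" where
  "left_nbr s u = {u(n - 1 := \<not> u (n - 1)) | n. n \<ge> 1 \<and> tau_L s u = enat n}"

definition type3 :: "real \<Rightarrow> (nat \<Rightarrow> bool) \<Rightarrow> (nat \<Rightarrow> real) \<Rightarrow> bool" where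
  "type3 s L p \<longleftrightarrow> folding_point s p \<and>
     (\<exists>a\<in>draw s L p. accessible (core_image s L) a) \<and>
     (\<exists>t. itinerary s p t \<and>
        (\<forall>u \<in> {left_part t} \<union> right_nbr s (left_part t) \<union> left_nbr s (left_part t).
           \<not> cylinder_extremum s L u))"

end

theory Submission
  imports Defs
begin

text \<open>
  Since \<open>c\<close> is preperiodic to the orbit \<open>\<omega>\<close> of \<open>T\<^sup>3(c)\<close>, a point with a coordinate outside \<open>\<omega>\<close>
  has coordinates away from the whole critical orbit, and near it the core is an interval times
  the set of branches of a tree that splits at least once in any two consecutive levels
  (because \<open>T\<^sup>2(c) + T\<^sup>3(c) < 1\<close> for \<open>s > \<surd>2\<close>), that is, a Cantor set. So a folding point
  \<open>p\<close> has all its coordinates in \<open>\<omega>\<close>, and its left part is a shift of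
  \<open>(c\<^sub>3 \<dots> c\<^bsub>n+2\<^esub>)\<^sup>\<infinity>\<close>. The arcs that turn at \<open>p\<close> leave this itinerary by reading
  \<open>1 0 c\<^sub>3 \<dots>\<close> instead of \<open>0 1 c\<^sub>3 \<dots>\<close>. Take for \<open>L\<close> the shift of \<open>(1 0 c\<^sub>3 \<dots> c\<^sub>n)\<^sup>\<infinity>\<close> with the
  same alignment. Relative to \<open>L\<close>, the sequences that leave the itinerary of \<open>p\<close> at one of these
  places all lie on one side of \<open>p\<close> vertically, and all others on the opposite side. Both kinds
  occur at arbitrary depth, also for the neighbours of \<open>p\<close>, so none of them is an extremum of a
  cylinder. On the first side only arcs ending at \<open>p\<close> accumulate; as a period has an odd number
  of ones, they end alternately on the left and on the right of \<open>p\<close>, and a curve that zigzags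
  between them reaches \<open>p\<close>.
\<close>

section \<open>Closed itineraries of the tent map\<close>

definition side :: "bool \<Rightarrow> real set" where
  "side d = (if d then {1/2..1} else {0..1/2})"

definition follows :: "real \<Rightarrow> real \<Rightarrow> bool list \<Rightarrow> bool" where
  "follows s x w \<longleftrightarrow> (\<forall>i<length w. (tent s ^^ i) x \<in> side (w ! i))"

lemma follows_Nil [simp]: "follows s x []"
  by (simp add: follows_def)

lemma follows_Cons [simp]:
  "follows s x (d # w) \<longleftrightarrow> x \<in> side d \<and> follows s (tent s x) w"
  by (auto simp: follows_def nth_Cons funpow_swap1 less_Suc_eq_0_disj split: nat.splits)

lemma follows_append:
  "follows s x (v @ w) \<longleftrightarrow> follows s x v \<and> follows s ((tent s ^^ length v) x) w"
  by (induction v arbitrary: x) (auto simp: funpow_swap1)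

lemma ones_Nil [simp]: "ones [] = 0"
  and ones_Cons [simp]: "ones (d # w) = (if d then Suc (ones w) else ones w)"
  and ones_append [simp]: "ones (v @ w) = ones v + ones w"
  by (auto simp: ones_def)

lemma tent_side:
  assumes "0 \<le> s" "x \<in> side d"
  shows "tent s x = (if d then s * (1 - x) else s * x)"
proof (cases d)
  case True
  then have "s * (1 - x) \<le> s * x"
    using assms by (intro mult_left_mono) (auto simp: side_def)
  then show ?thesis using True by (simp add: tent_def)
next
  case False
  then have "s * x \<le> s * (1 - x)"
    using assms by (intro mult_left_mono) (auto simp: side_def)
  then show ?thesis using False by (simp add: tent_def)
qed

text \<open>Each branch of the tent map is affine with slope \<open>s\<close> or \<open>- s\<close>,
  so along a common itinerary the iterate is affine and every digit 1 contributes one sign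
  change.\<close>

lemma follows_expand:
  assumes "0 \<le> s" "follows s x w" "follows s y w"
  shows "(tent s ^^ length w) x - (tent s ^^ length w) y = (-1) ^ ones w * s ^ length w * (x - y)"
  using assms(2,3)
proof (induction w arbitrary: x y)
  case (Cons d w)
  have "tent s x - tent s y = (if d then - s else s) * (x - y)"
    using Cons.prems tent_side[OF assms(1)] by (auto simp: algebra_simps)
  then show ?case
    using Cons.IH[of "tent s x" "tent s y"] Cons.prems
    by (auto simp del: funpow.simps simp add: funpow_Suc_right)
qed simp

lemma plex_less_Nil [simp]: "\<not> plex_less [] v" "\<not> plex_less v []"
  by (auto simp: plex_less_def)

lemma plex_less_Cons [simp]:
  "plex_less (a # u) (b # v) \<longleftrightarrow> length u = length v \<and>
     (\<not> a \<and> b \<or> a = b \<and> (if a then plex_less v u else plex_less u v))"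
proof (cases "length u = length v")
  case len: True
  have Ex: "(\<exists>k<Suc m. P k) \<longleftrightarrow> P 0 \<or> (\<exists>k<m. P (Suc k))" for P and m :: nat
    by (auto simp: less_Suc_eq_0_disj)
  show ?thesis
  proof (cases "a = b")
    case True
    have "(\<exists>k<length u. take k u = take k v \<and>
        (\<not> u ! k \<and> v ! k \<and> odd (ones (take k u)) \<or> u ! k \<and> \<not> v ! k \<and> even (ones (take k u)))) \<longleftrightarrow>
      plex_less v u"
      unfolding plex_less_def using len by (auto; metis)
    then show ?thesis
      using len True by (cases b) (simp_all add: plex_less_def Ex)
  next
    case False
    then show ?thesis
      unfolding plex_less_def length_Cons Ex using len by (cases b) simp_all
  qed
qed (simp add: plex_less_def)

lemma plex_less_total: "length u = length v \<Longrightarrow> u = v \<or> plex_less u v \<or> plex_less v u"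
  by (induction u v rule: list_induct2) auto

text \<open>Digit 0 preserves and digit 1 reverses the order of points, which is what the parity in
  \<open>plex_less\<close> records. The point \<open>1/2\<close> lies on both sides; excluding it
  from one of the two orbits makes the inequality strict at the first differing digit.\<close>

lemma plex_less_imp_less:
  assumes "0 < s" "plex_less u v" "follows s x u" "follows s y v"
    and "(\<forall>i. (tent s ^^ i) x \<noteq> 1/2) \<or> (\<forall>i. (tent s ^^ i) y \<noteq> 1/2)"
  shows "x < y"
proof -
  have len: "length u = length v"
    using assms(2) by (auto simp: plex_less_def)
  \<comment> \<open>Both directions are proved together because a common digit 1 exchanges the roles
    of the two words.\<close>
  have "(plex_less u v \<longrightarrow> x < y) \<and> (plex_less v u \<longrightarrow> y < x)"
    using len assms(3-5)
  proof (induction u v arbitrary: x y rule: list_induct2)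
    case (Cons a u b v)
    have nc: "(\<forall>i. (tent s ^^ i) (tent s x) \<noteq> 1/2) \<or> (\<forall>i. (tent s ^^ i) (tent s y) \<noteq> 1/2)"
      using Cons.prems(3) by (metis funpow_swap1 funpow_simps_right(2) comp_apply)
    have IH: "(plex_less u v \<longrightarrow> tent s x < tent s y) \<and> (plex_less v u \<longrightarrow> tent s y < tent s x)"
      using Cons.IH[of "tent s x" "tent s y"] Cons.prems nc by simp
    have ne: "x \<noteq> 1/2 \<or> y \<noteq> 1/2"
      using Cons.prems(3) by (metis funpow_0)
    show ?case
    proof (cases "a = b")
      case True
      then have "tent s x = (if a then s * (1 - x) else s * x)" "tent s y = (if a then s * (1 - y) else s * y)"
        using Cons.prems tent_side[of s] assms(1) by auto
      then show ?thesis using IH True \<open>0 < s\<close> by auto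
    next
      case False
      then show ?thesis using Cons.prems ne by (cases a; cases b) (auto simp: side_def)
    qed
  qed simp
  then show ?thesis using assms(2) by blast
qed

section \<open>The critical orbit\<close>

lemma cycle_seq_add: "cycle_seq w (i + q * length w) = cycle_seq w i"
  by (simp add: cycle_seq_def)

locale tent_map =
  fixes s :: real
  assumes s_gt: "sqrt 2 < s" and s_le: "s \<le> 2"
begin

abbreviation cr :: "nat \<Rightarrow> real" where
  "cr j \<equiv> (tent s ^^ j) (1/2)"

lemma s_gt_1: "1 < s"
  using s_gt by (smt (verit) real_sqrt_gt_1_iff)

lemma s_square: "2 < s * s"
proof -
  have "sqrt 2 * sqrt 2 < s * s"
    using s_gt s_gt_1 by (intro mult_strict_mono) auto
  then show ?thesis by simp
qed

lemma cr1: "cr 1 = s / 2"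
  by (simp add: tent_def)

lemma cr2: "cr 2 = s * (1 - s / 2)"
proof -
  have "1 - s/2 \<le> s/2" using s_gt_1 by simp
  then have "s * (1 - s/2) \<le> s * (s/2)" using s_gt_1 by (intro mult_left_mono) auto
  then show ?thesis
    by (simp add: numeral_2_eq_2 tent_def min_def)
qed

lemma cr2_bounds: "0 \<le> cr 2" "cr 2 < 1/2"
proof -
  show "0 \<le> cr 2" unfolding cr2 using s_gt_1 s_le by simp
  have "0 < (s - 1)^2" using s_gt_1 by simp
  then show "cr 2 < 1/2" unfolding cr2 by (simp add: power2_eq_square algebra_simps)
qed

lemma cr3: "cr 3 = s * cr 2"
proof -
  have "cr 3 = tent s (cr 2)" by (simp add: numeral_3_eq_3 numeral_2_eq_2)
  then show ?thesis using tent_side[of s "cr 2" False] cr2_bounds s_gt_1 by (simp add: side_def)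
qed

text \<open>This is where \<open>s > \<surd>2\<close> enters: the identity
  \<open>2 (1 - cr 2 - cr 3) = (s - 1) (s\<^sup>2 - 2)\<close>.\<close>

lemma cr2_cr3: "cr 2 + cr 3 < 1"
proof -
  have "0 < (s - 1) * (s * s - 2)"
    using s_gt_1 s_square by simp
  then show ?thesis unfolding cr3 cr2 by (simp add: algebra_simps)
qed

lemma cr2_le_cr3: "cr 2 \<le> cr 3"
  using cr3 cr2_bounds s_gt_1 by (simp add: mult_le_cancel_right1)

lemma cr1_bounds: "1/2 < cr 1" "cr 1 \<le> 1"
  unfolding cr1 using s_gt_1 s_le by auto

lemma tent_core:
  assumes "x \<in> {cr 2..cr 1}"
  shows "tent s x \<in> {cr 2..cr 1}"
proof -
  have "tent s x \<le> s/2"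
  proof (cases "x \<le> 1/2")
    case True
    then have "s * x \<le> s * (1/2)" using s_gt_1 by (intro mult_left_mono) auto
    then show ?thesis by (simp add: tent_def)
  next
    case False
    then have "s * (1 - x) \<le> s * (1/2)" using s_gt_1 by (intro mult_left_mono) auto
    then show ?thesis by (simp add: tent_def)
  qed
  moreover have "s * cr 2 \<le> s * x" "s * (1 - s/2) \<le> s * (1 - x)"
    using assms s_gt_1 unfolding cr1 by (auto intro!: mult_left_mono)
  ultimately show ?thesis
    using cr2_le_cr3 unfolding atLeastAtMost_iff cr1 cr3 using cr2 by (simp add: tent_def)
qed

lemma tent_iter_core: "x \<in> {cr 2..cr 1} \<Longrightarrow> (tent s ^^ j) x \<in> {cr 2..cr 1}"
proof (induction j)
  case (Suc j)
  then show ?case using tent_core by simp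
qed simp

lemma cr_core: "1 \<le> j \<Longrightarrow> cr j \<in> {cr 2..cr 1}"
proof (induction j rule: dec_induct)
  case base
  then show ?case using cr2_bounds cr1_bounds by simp
next
  case (step j)
  then show ?case using tent_core by simp
qed

lemma cr_add: "(tent s ^^ j) (cr i) = cr (i + j)"
  using funpow_add[of j i "tent s"] by (simp add: add.commute)

lemma core_unit: "x \<in> {cr 2..cr 1} \<Longrightarrow> x \<in> {0..1}"
  using cr2_bounds cr1_bounds by auto

lemma side_cases: "x \<in> {0..1} \<Longrightarrow> x \<in> side (1/2 \<le> x)"
  by (auto simp: side_def)

text \<open>Expansivity: along a common itinerary the distance grows like \<open>s ^ m\<close>, but
  it never exceeds 1.\<close>

lemma follows_unique:
  assumes "\<And>i. (tent s ^^ i) x \<in> side (d i)" "\<And>i. (tent s ^^ i) y \<in> side (d i)"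
  shows "x = y"
proof (rule ccontr)
  assume ne: "x \<noteq> y"
  have unit: "side e \<subseteq> {0..1}" for e by (auto simp: side_def)
  have "s ^ m * \<bar>x - y\<bar> \<le> 1" for m
  proof -
    have "follows s x (map d [0..<m])" "follows s y (map d [0..<m])"
      using assms by (auto simp: follows_def)
    from follows_expand[OF _ this]
    have "(tent s ^^ m) x - (tent s ^^ m) y = (-1) ^ ones (map d [0..<m]) * s ^ m * (x - y)"
      using s_gt_1 by simp
    then have "\<bar>(tent s ^^ m) x - (tent s ^^ m) y\<bar> = s ^ m * \<bar>x - y\<bar>"
      using s_gt_1 by (simp add: abs_mult power_abs)
    moreover have "(tent s ^^ m) x \<in> {0..1}" "(tent s ^^ m) y \<in> {0..1}"
      using assms unit by blast+
    ultimately show ?thesis by auto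
  qed
  moreover obtain m where "1 / \<bar>x - y\<bar> < s ^ m"
    using real_arch_pow[OF s_gt_1] by blast
  ultimately show False using ne by (smt (verit) pos_divide_less_eq zero_less_abs_iff)
qed

end

section \<open>Critical orbit under the preperiodic kneading sequence\<close>

locale tent_kneading = tent_map +
  fixes n :: nat
  assumes n_ge_1: "n \<ge> 1"
    and k2: "\<not> kneading s 2"
    and k_period: "\<forall>i\<ge>3. kneading s (i + n) = kneading s i"
    and k_odd: "odd (ones (kneading_word s 3 n))"
    and k_n2: "kneading s (n + 2)"
    and k_n1: "\<not> kneading s (n + 1)"
begin

lemma k_period_mult: "3 \<le> i \<Longrightarrow> kneading s (i + q * n) = kneading s i"
proof (induction q)
  case (Suc q)
  then show ?case using k_period[rule_format, of "i + q * n"] by (simp add: algebra_simps)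
qed simp

text \<open>A periodic critical point would make the kneading sequence purely periodic,
  contradicting that \<open>n + 2\<close> and \<open>2\<close> carry different digits.\<close>

lemma cr_ne:
  assumes "1 \<le> j"
  shows "cr j \<noteq> 1/2"
proof
  assume j: "cr j = 1/2"
  define m where "m = (LEAST m. 1 \<le> m \<and> cr m = 1/2)"
  have ex: "\<exists>m\<ge>1. cr m = 1/2" using assms j by blast
  have m: "1 \<le> m"
    using LeastI[of "\<lambda>m. 1 \<le> m \<and> cr m = 1/2" j] assms j unfolding m_def by blast
  define a where "a = map (crit_digit s) [1..<m] @ [False]"
  define b where "b = map (crit_digit s) [1..<m] @ [True]"
  have len: "length a = m" "length b = m"
    using m by (auto simp: a_def b_def)
  have k: "kneading s i = (if plex_less_seq (cycle_seq a) (cycle_seq b) then cycle_seq a else cycle_seq b) (i - 1)" for i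
    using ex by (simp add: kneading_def m_def a_def b_def Let_def)
  have "kneading s (2 + n * m) = kneading s 2"
    using cycle_seq_add[of a 1 n] cycle_seq_add[of b 1 n] len by (simp add: k)
  \<comment> \<open>This index exceeds \<open>2\<close> by a multiple of the supposed period
    \<open>m\<close> and \<open>n + 2\<close> by a multiple of \<open>n\<close>.\<close>
  moreover have "2 + n * m = (n + 2) + (m - 1) * n"
    using m by (cases m) auto
  moreover have "kneading s ((n + 2) + (m - 1) * n) = kneading s (n + 2)"
    using n_ge_1 by (intro k_period_mult) auto
  ultimately show False using k2 k_n2 by metis
qed

lemma kneading_eq: "kneading s i \<longleftrightarrow> 1/2 \<le> cr i"
proof -
  have "\<not> (\<exists>m\<ge>1. cr m = 1/2)" using cr_ne by blast
  then show ?thesis unfolding kneading_def crit_digit_def by metis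
qed

lemma cr_side: "1 \<le> i \<Longrightarrow> cr i \<in> side (kneading s i)"
  using core_unit[OF cr_core] by (auto simp: side_def kneading_eq)

lemma follows_kneading: "1 \<le> i \<Longrightarrow> follows s (cr i) (kneading_word s i m)"
  using cr_side by (auto simp: follows_def kneading_word_def cr_add simp del: funpow.simps)

lemma cr_period: "3 \<le> i \<Longrightarrow> cr (i + n) = cr i"
proof (rule follows_unique[where d = "\<lambda>j. kneading s (i + j)"])
  fix j assume i: "3 \<le> i"
  have "(tent s ^^ j) (cr (i + n)) = cr ((i + j) + n)"
    using funpow_add[of j "i + n" "tent s"] by (simp add: algebra_simps)
  then show "(tent s ^^ j) (cr (i + n)) \<in> side (kneading s (i + j))"
    using cr_side[of "i + j + n"] k_period i by simp
  have "(tent s ^^ j) (cr i) = cr (i + j)"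
    using funpow_add[of j "i" "tent s"] by (simp add: algebra_simps)
  then show "(tent s ^^ j) (cr i) \<in> side (kneading s (i + j))"
    using cr_side[of "i + j"] i by simp
qed

lemma cr_period_mult: "3 \<le> i \<Longrightarrow> cr (i + q * n) = cr i"
proof (induction q)
  case (Suc q)
  then show ?case using cr_period[of "i + q * n"] by (simp add: algebra_simps)
qed simp

lemma cr_mod_eq:
  assumes "3 \<le> i" "3 \<le> j" "i mod n = j mod n"
  shows "cr i = cr j"
proof -
  have *: "cr i = cr j" if "3 \<le> i" "i \<le> j" "i mod n = j mod n" for i j
  proof -
    have "n dvd j - i" using mod_eq_dvd_iff_nat[of i j n] that by simp
    then obtain q where "j = i + n * q" using \<open>i \<le> j\<close> by (metis dvdE le_add_diff_inverse)
    then show ?thesis using cr_period_mult[of i q] that by (simp add: mult.commute)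
  qed
  show ?thesis using * assms by (metis nat_le_linear)
qed

text \<open>For \<open>n = 1\<close> the point \<open>cr 3\<close> would be fixed on the right side,
  so \<open>s * cr 2 = s * (1 - cr 3)\<close>, against \<open>cr2_cr3\<close>.\<close>

lemma n_ge_2: "2 \<le> n"
proof (rule ccontr)
  assume "\<not> 2 \<le> n"
  then have n1: "n = 1" using n_ge_1 by simp
  then have "cr 3 = tent s (cr 3)" using cr_period[of 3] cr_add[of 1 3] by simp
  moreover have "cr 3 \<in> side True" using cr_side[of 3] k_n2 n1 by (simp add: numeral_3_eq_3 numeral_2_eq_2)
  ultimately have "cr 3 = s * (1 - cr 3)" using tent_side[of s "cr 3" True] s_gt_1 by simp
  then have "s * cr 2 = s * (1 - cr 3)" using cr3 by simp
  then show False using cr2_cr3 s_gt_1 by auto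
qed

text \<open>A return to \<open>cr 2\<close> would make it periodic with period \<open>j - 2\<close>;
  after \<open>n * (j - 2)\<close> steps it would then equal \<open>cr (n + 2)\<close>, which has
  the other digit.\<close>

lemma cr_2_notin: "3 \<le> j \<Longrightarrow> cr j \<noteq> cr 2"
proof
  assume j: "3 \<le> j" "cr j = cr 2"
  have *: "cr (2 + q * (j - 2)) = cr 2" for q
  proof (induction q)
    case (Suc q)
    have "2 + Suc q * (j - 2) = j + q * (j - 2)" using j by simp
    then have "cr (2 + Suc q * (j - 2)) = (tent s ^^ (q * (j - 2))) (cr j)"
      unfolding cr_add by (rule arg_cong)
    also have "\<dots> = cr (2 + q * (j - 2))"
      unfolding j(2) cr_add ..
    finally show ?case using Suc by simp
  qed simp
  have "cr (2 + n * (j - 2)) = cr (2 + n)"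
  proof (rule cr_mod_eq)
    have "1 \<le> n * (j - 2)" using j n_ge_1 by (simp add: Suc_le_eq)
    then show "3 \<le> 2 + n * (j - 2)" by simp
    show "(2 + n * (j - 2)) mod n = (2 + n) mod n"
      unfolding mod_mult_self2 mod_add_self2 ..
  qed (use n_ge_1 in simp)
  then have "cr 2 = cr (n + 2)" using *[of n] by (simp add: add.commute)
  then show False using k2 k_n2 by (simp add: kneading_eq)
qed

lemma cr_1_notin: "2 \<le> j \<Longrightarrow> cr j \<noteq> cr 1"
proof
  assume j: "2 \<le> j" "cr j = cr 1"
  then have "cr (Suc j) = cr 2" by (simp add: numeral_2_eq_2)
  then show False using cr_2_notin[of "Suc j"] j by simp
qed

text \<open>\<open>cr (n + 2)\<close> has the same image as \<open>cr 2\<close> but lies on the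
  right, so it is the mirror image of \<open>cr 2\<close>.\<close>

lemma cr_n2: "cr (n + 2) = 1 - cr 2"
proof -
  have "tent s (cr (n + 2)) = cr 3"
    using cr_period[of 3] by (simp add: numeral_3_eq_3 numeral_2_eq_2)
  moreover have "cr (n + 2) \<in> side True" using cr_side[of "n + 2"] k_n2 by simp
  ultimately have "s * (1 - cr (n + 2)) = s * cr 2"
    using tent_side[of s "cr (n + 2)" True] s_gt_1 cr3 by simp
  then show ?thesis using s_gt_1 by simp
qed

end

section \<open>Backward branches and admissibility\<close>

text \<open>Repeated preimages of \<open>y\<close>, with the inverse branch at depth
  \<open>i\<close> chosen by the digit \<open>u i\<close>.\<close>

primrec branch :: "real \<Rightarrow> (nat \<Rightarrow> bool) \<Rightarrow> real \<Rightarrow> nat \<Rightarrow> real" where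
  "branch s u y 0 = y"
| "branch s u y (Suc i) = (if u i then 1 - branch s u y i / s else branch s u y i / s)"

lemma branch_cong: "(\<And>j. j < i \<Longrightarrow> u j = v j) \<Longrightarrow> branch s u y i = branch s v y i"
  by (induction i) auto

lemma continuous_on_branch:
  assumes "s \<noteq> 0" "continuous_on A f" "\<And>i. continuous_on A (\<lambda>x. of_bool (u x i) :: real)"
  shows "continuous_on A (\<lambda>x. branch s (u x) (f x) i)"
proof (induction i)
  case (Suc i)
  have "branch s (u x) (f x) (Suc i) = of_bool (u x i) * (1 - branch s (u x) (f x) i / s) +
      (1 - of_bool (u x i)) * (branch s (u x) (f x) i / s)" for x
    by simp
  then show ?case using Suc assms by (auto intro!: continuous_intros)
qed (use assms in simp)

lemma left_word_Suc: "left_word u (Suc k) = u k # left_word u k"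
  by (simp add: left_word_def)

lemma left_word_cong: "(\<And>j. j < k \<Longrightarrow> u j = v j) \<Longrightarrow> left_word u k = left_word v k"
  by (auto simp: left_word_def)

lemma length_left_word [simp]: "length (left_word u k) = k"
  by (simp add: left_word_def)

lemma left_word_0 [simp]: "left_word u 0 = []"
  by (simp add: left_word_def)

lemma adm_word_ConsD:
  assumes "adm_word s (d # w)"
  shows "adm_word s w" "plex_le (kneading_word s 2 (Suc (length w))) (d # w)"
proof -
  have "plex_le (kneading_word s 2 (length w - i)) (drop i w) \<and>
        plex_le (drop i w) (kneading_word s 1 (length w - i))" if "i < length w" for i
    using assms[unfolded adm_word_def, rule_format, of "Suc i"] that by simp
  then show "adm_word s w" by (simp add: adm_word_def)
  show "plex_le (kneading_word s 2 (Suc (length w))) (d # w)"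
    using assms[unfolded adm_word_def, rule_format, of 0] by simp
qed

context tent_map
begin

lemma tent_inverse:
  assumes "x \<in> side d"
  shows "x = (if d then 1 - tent s x / s else tent s x / s)"
  using tent_side[OF _ assms] s_gt_1 by auto

lemma tent_preimage:
  assumes "y \<in> {0..s/2}"
  shows "tent s (if d then 1 - y / s else y / s) = y" "(if d then 1 - y / s else y / s) \<in> side d"
proof -
  have "y / s \<le> 1/2" "0 \<le> y / s"
    using assms s_gt_1 by (auto simp: field_simps)
  then show *: "(if d then 1 - y / s else y / s) \<in> side d"
    by (auto simp: side_def)
  show "tent s (if d then 1 - y / s else y / s) = y"
    using tent_side[OF _ *] s_gt_1 by auto
qed

lemma core_range: "x \<in> {cr 2..cr 1} \<Longrightarrow> x \<in> {0..s/2}"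
  using cr2_bounds cr1 by auto

lemma right_preimage_core: "y \<in> {cr 2..cr 1} \<Longrightarrow> 1 - y / s \<in> {cr 2..cr 1}"
proof -
  assume y: "y \<in> {cr 2..cr 1}"
  have "1 - y / s \<ge> 1/2"
    using tent_preimage(2)[OF core_range[OF y], of True] by (simp add: side_def)
  moreover have "cr 2 / s \<le> y / s"
    using y s_gt_1 by (intro divide_right_mono) auto
  moreover have "cr 2 / s = 1 - s / 2"
    unfolding cr2 using s_gt_1 by simp
  ultimately show ?thesis
    using cr2_bounds unfolding atLeastAtMost_iff cr1 by auto
qed

text \<open>Since \<open>cr 3 = s * cr 2\<close>, the lower end of the core is the only obstruction.
  Together with the right preimage, which always stays in the core, this describes all backward
  choices: digit 1 is always possible, digit 0 needs \<open>cr 3 \<le> y\<close>.\<close>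

lemma left_preimage_core:
  assumes "y \<in> {cr 2..cr 1}"
  shows "y / s \<in> {cr 2..cr 1} \<longleftrightarrow> cr 3 \<le> y"
proof -
  have "y / s \<le> 1/2"
    using tent_preimage(2)[OF core_range[OF assms], of False] by (simp add: side_def)
  then have "y / s \<le> cr 1" using cr1_bounds(1) by linarith
  then show ?thesis unfolding cr3 atLeastAtMost_iff using s_gt_1 by (auto simp: field_simps)
qed

lemma core_iff:
  "x \<in> core s \<longleftrightarrow> (\<forall>i. tent s (x (Suc i)) = x i) \<and> (\<forall>i. x i \<in> {cr 2..cr 1})"
proof -
  have "tent s (tent s (1/2)) = cr 2" "tent s (1/2) = cr 1"
    by (simp_all add: numeral_2_eq_2)
  then show ?thesis
    unfolding core_def inv_limit_def mem_Collect_eq using core_unit by metis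
qed

lemma core_tent: "x \<in> core s \<Longrightarrow> tent s (x (Suc i)) = x i"
  and core_mem: "x \<in> core s \<Longrightarrow> x i \<in> {cr 2..cr 1}"
  by (auto simp: core_iff)

lemma core_iter: "x \<in> core s \<Longrightarrow> (tent s ^^ j) (x (i + j)) = x i"
  by (induction j) (auto simp del: funpow.simps simp add: funpow_Suc_right core_tent)

lemma branch_core:
  assumes "\<And>i. branch s u y i \<in> {cr 2..cr 1}"
  shows "branch s u y \<in> core s" "branch s u y (Suc i) \<in> side (u i)"
  using tent_preimage[OF core_range[OF assms]] assms by (auto simp: core_iff)

lemma core_eq_branch:
  assumes "x \<in> core s" "\<And>i. x (Suc (m + i)) \<in> side (u i)"
  shows "x (m + i) = branch s u (x m) i"
proof (induction i)
  case (Suc i)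
  have "x (Suc (m + i)) = (if u i then 1 - x (m + i) / s else x (m + i) / s)"
    using tent_inverse[OF assms(2)[of i]] unfolding core_tent[OF assms(1)] .
  then show ?case using Suc by simp
qed simp

lemma follows_left_word:
  assumes "x \<in> core s" "\<And>i. i < k \<Longrightarrow> x (Suc (m + i)) \<in> side (u i)"
  shows "follows s (x (m + k)) (left_word u k)"
  using assms(2)
proof (induction k)
  case (Suc k)
  then show ?case using core_tent[OF assms(1)] by (simp add: left_word_Suc)
qed simp

lemma coord_step:
  assumes "x \<in> core s"
  shows "coord s x (i + 1) = tent s (coord s x i)"
proof (cases "i < 0")
  case True
  then have "nat (- i) = Suc (nat (- (i + 1)))" by simp
  then show ?thesis using True core_tent[OF assms] by (simp add: coord_def)
next
  case False
  then have "nat (i + 1) = Suc (nat i)" by simp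
  then show ?thesis using False by (cases "i = 0") (simp_all add: coord_def)
qed

lemma coord_iter: "x \<in> core s \<Longrightarrow> coord s x (i + int j) = (tent s ^^ j) (coord s x i)"
proof (induction j)
  case (Suc j)
  then show ?case using coord_step[of x "i + int j"] by (simp add: algebra_simps)
qed simp

lemma coord_core: "x \<in> core s \<Longrightarrow> coord s x i \<in> {cr 2..cr 1}"
  using core_mem tent_iter_core by (simp add: coord_def)

lemma follows_coord:
  assumes "x \<in> core s" "\<And>k. coord s x k \<in> side (t k)"
  shows "follows s (coord s x i) (map t [i..j])"
  using assms(2) by (auto simp: follows_def nth_upto simp flip: coord_iter[OF assms(1)])

end

section \<open>Admissible sequences as itineraries in the core\<close>

context tent_kneading
begin

lemma cr_iter_ne: "1 \<le> i \<Longrightarrow> \<forall>j. (tent s ^^ j) (cr i) \<noteq> 1/2"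
  using cr_ne[of "i + j" for j] unfolding cr_add by auto

text \<open>Every iterate lies between \<open>cr 2\<close> and \<open>cr 1\<close>. A violated word
  inequality would put it strictly outside, since the orbits of these endpoints avoid
  \<open>1/2\<close>.\<close>

lemma adm_word_follows:
  assumes "x \<in> {cr 2..cr 1}" "follows s x w"
  shows "adm_word s w"
  unfolding adm_word_def
proof (intro allI impI)
  fix i assume i: "i < length w"
  define y where "y = (tent s ^^ i) x"
  have y: "y \<in> {cr 2..cr 1}"
    unfolding y_def using assms(1) by (rule tent_iter_core)
  have fy: "follows s y (drop i w)"
    using assms(2) follows_append[of s x "take i w" "drop i w"] i by (simp add: y_def)
  have *: "\<not> plex_less (drop i w) (kneading_word s 2 (length w - i))"
  proof
    assume "plex_less (drop i w) (kneading_word s 2 (length w - i))"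
    from plex_less_imp_less[OF _ this fy follows_kneading] cr_iter_ne[of 2] s_gt_1
    have "y < cr 2" by simp
    then show False using y by simp
  qed
  have **: "\<not> plex_less (kneading_word s 1 (length w - i)) (drop i w)"
  proof
    assume "plex_less (kneading_word s 1 (length w - i)) (drop i w)"
    from plex_less_imp_less[OF _ this follows_kneading fy] cr_iter_ne[of 1] s_gt_1
    have "cr 1 < y" by simp
    then show False using y by simp
  qed
  have len: "length (kneading_word s j (length w - i)) = length (drop i w)" for j
    by (simp add: kneading_word_def)
  show "plex_le (kneading_word s 2 (length w - i)) (drop i w) \<and>
        plex_le (drop i w) (kneading_word s 1 (length w - i))"
    unfolding plex_le_def
    using * ** plex_less_total[OF len[of 2]] plex_less_total[OF len[of 1]] by metis
qed

text \<open>The point is built by pulling back from the last letter. Only a digit 0 is a constraint,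
  and there admissibility compares the remaining word with the itinerary of
  \<open>cr 3\<close>.\<close>

lemma adm_word_realized:
  assumes "adm_word s w"
  obtains x where "x \<in> {cr 2..cr 1}" "follows s x w"
proof -
  have "\<exists>x\<in>{cr 2..cr 1}. follows s x w"
    using assms
  proof (induction w)
    case Nil
    then show ?case using cr_core[of 1] by auto
  next
    case (Cons d w)
    then obtain x where x: "x \<in> {cr 2..cr 1}" "follows s x w"
      using adm_word_ConsD(1) by blast
    show ?case
    proof (cases d)
      case True
      then show ?thesis
        using x right_preimage_core[of x] tent_preimage[OF core_range[of x], of True]
        by (intro bexI[of _ "1 - x / s"]) auto
    next
      case False
      have k3: "kneading_word s 2 (Suc (length w)) = False # kneading_word s 3 (length w)"
        using k2 unfolding kneading_word_def
        by (subst upt_conv_Cons) (auto simp del: upt_Suc simp: numeral_3_eq_3 numeral_2_eq_2)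
      have "\<exists>x\<in>{cr 2..cr 1}. follows s x w \<and> cr 3 \<le> x"
      \<comment> \<open>If the remaining word is a prefix of the itinerary of \<open>cr 3\<close>,
        the inductive point may lie below \<open>cr 3\<close>, so it is replaced by
        \<open>cr 3\<close> itself.\<close>
      proof (cases "w = kneading_word s 3 (length w)")
        case True
        then show ?thesis
          using cr_core[of 3] follows_kneading[of 3 "length w"] by (intro bexI[of _ "cr 3"]) auto
      next
        case ne: False
        then have "plex_less (kneading_word s 3 (length w)) w"
          using adm_word_ConsD(2)[OF Cons.prems] False unfolding plex_le_def k3 by auto
        from plex_less_imp_less[OF _ this follows_kneading x(2)] cr_iter_ne[of 3] s_gt_1
        have "cr 3 < x" by simp
        then show ?thesis using x by (intro bexI[of _ x]) auto
      qed
      then obtain x where x: "x \<in> {cr 2..cr 1}" "follows s x w" "cr 3 \<le> x" by blast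
      then show ?thesis
        using False left_preimage_core[of x] tent_preimage[OF core_range[of x], of False]
        by (intro bexI[of _ "x / s"]) auto
    qed
  qed
  then show thesis using that by blast
qed

lemma left_adm_core_of_core:
  assumes "x \<in> core s" "\<And>i. x (Suc (m + i)) \<in> side (u i)"
  shows "left_adm_core s u"
  unfolding left_adm_core_def
proof (intro allI)
  fix i j
  show "adm_word s (map u (rev [i..<j]))"
  proof (cases "i \<le> j")
    case True
    have "map u (rev [i..<j]) = left_word (\<lambda>k. u (i + k)) (j - i)"
      using True by (intro nth_equalityI) (simp_all add: left_word_def rev_nth)
    moreover have "follows s (x ((m + i) + (j - i))) (left_word (\<lambda>k. u (i + k)) (j - i))"
      using assms by (intro follows_left_word) (auto simp: add.assoc)
    ultimately show ?thesis using adm_word_follows core_mem[OF assms(1)] by metis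
  qed (simp add: adm_word_def)
qed

text \<open>Compactness: finite left words give base points whose branches stay in the core to
  larger and larger depth, and a limit of these base points works at every depth.\<close>

lemma left_adm_core_realized:
  assumes "left_adm_core s u"
  obtains x where "x \<in> core s" "\<And>i. x (Suc i) \<in> side (u i)"
proof -
  have "\<exists>y. \<forall>i\<le>m. branch s u y i \<in> {cr 2..cr 1}" for m
  proof -
    have "adm_word s (left_word u m)"
      using assms unfolding left_adm_core_def left_word_def by blast
    then obtain x where x: "x \<in> {cr 2..cr 1}" "follows s x (left_word u m)"
      using adm_word_realized by blast
    define y where "y = (tent s ^^ m) x"
    have "branch s u y i = (tent s ^^ (m - i)) x" if "i \<le> m" for i
      using that
    proof (induction i)
      case (Suc i)
      have "(tent s ^^ (m - Suc i)) x \<in> side (left_word u m ! (m - Suc i))"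
        using x(2) Suc.prems unfolding follows_def by simp
      also have "left_word u m ! (m - Suc i) = u i"
        using Suc.prems by (simp add: left_word_def rev_nth)
      finally have "(tent s ^^ (m - Suc i)) x \<in> side (u i)" .
      from tent_inverse[OF this]
      have "(tent s ^^ (m - Suc i)) x =
          (if u i then 1 - (tent s ^^ (m - i)) x / s else (tent s ^^ (m - i)) x / s)"
        unfolding Suc_diff_Suc[symmetric, OF Suc_le_lessD[OF Suc.prems]] funpow.simps(2) comp_apply .
      then show ?case using Suc by simp
    qed (simp add: y_def)
    then show ?thesis using tent_iter_core[OF x(1)] by metis
  qed
  then obtain y where y: "\<And>m i. i \<le> m \<Longrightarrow> branch s u (y m) i \<in> {cr 2..cr 1}"
    by metis
  have "y m \<in> {cr 2..cr 1}" for m using y[of 0 m] by simp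
  then obtain l r where lr: "l \<in> {cr 2..cr 1}" "strict_mono r" "(y \<circ> r) \<longlonglongrightarrow> l"
    using compact_Icc[of "cr 2" "cr 1"] unfolding compact_def by blast
  have "branch s u l i \<in> {cr 2..cr 1}" for i
  proof (rule Lim_in_closed_set[OF closed_atLeastAtMost])
    have "continuous_on UNIV (\<lambda>z. branch s u z i)"
      using s_gt_1 by (intro continuous_on_branch continuous_intros) auto
    then have "isCont (\<lambda>z. branch s u z i) l"
      by (simp add: continuous_on_eq_continuous_at)
    then show "((\<lambda>m. branch s u ((y \<circ> r) m) i) \<longlongrightarrow> branch s u l i) sequentially"
      using lr(3) by (rule isCont_tendsto_compose)
    show "\<forall>\<^sub>F m in sequentially. branch s u ((y \<circ> r) m) i \<in> {cr 2..cr 1}"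
    proof (rule eventually_sequentiallyI[of i])
      fix m assume "i \<le> m"
      also have "m \<le> r m" using lr(2) by (rule seq_suble)
      finally show "branch s u ((y \<circ> r) m) i \<in> {cr 2..cr 1}" using y by simp
    qed
  qed auto
  then show thesis using branch_core that by metis
qed

end

section \<open>Ternary series and the Cantor set\<close>

lemma ternary_sums: "(\<lambda>i. 2 / 3 ^ Suc (i + m) :: real) sums (1 / 3 ^ m)"
proof -
  have "(\<lambda>i. (2 / 3 ^ Suc m) * (1/3) ^ i) sums ((2 / 3 ^ Suc m) * (1 / (1 - 1/3 :: real)))"
    by (intro sums_mult geometric_sums) auto
  then show ?thesis by (simp add: power_add power_divide mult_ac)
qed

lemma ternary_summable:
  fixes e :: "nat \<Rightarrow> real"
  assumes "\<And>i. \<bar>e i\<bar> \<le> 2"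
  shows "summable (\<lambda>i. e i / 3 ^ Suc i)"
proof (rule summable_comparison_test')
  show "summable (\<lambda>i. 2 / 3 ^ Suc i :: real)"
    using ternary_sums[of 0] by (simp add: sums_iff)
  show "norm (e i / 3 ^ Suc i) \<le> 2 / 3 ^ Suc i" if "0 \<le> i" for i
    using assms[of i] by (simp add: divide_right_mono)
qed

lemma ternary_bound:
  fixes e :: "nat \<Rightarrow> real"
  assumes "\<And>i. \<bar>e i\<bar> \<le> 2" "\<And>i. i < m \<Longrightarrow> e i = 0"
  shows "\<bar>\<Sum>i. e i / 3 ^ Suc i\<bar> \<le> 1 / 3 ^ m"
proof -
  note S = ternary_summable[of e, OF assms(1)]
  have "(\<Sum>i. e i / 3 ^ Suc i) = (\<Sum>i. e (i + m) / 3 ^ Suc (i + m)) + (\<Sum>i<m. e i / 3 ^ Suc i)"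
    by (rule suminf_split_initial_segment[OF S])
  also have "(\<Sum>i<m. e i / 3 ^ Suc i) = 0"
    using assms(2) by simp
  finally have eq: "(\<Sum>i. e i / 3 ^ Suc i) = (\<Sum>i. e (i + m) / 3 ^ Suc (i + m))" by simp
  have "norm (\<Sum>i. e (i + m) / 3 ^ Suc (i + m)) \<le> (\<Sum>i. 2 / 3 ^ Suc (i + m))"
  proof (rule norm_suminf_le)
    show "summable (\<lambda>i. 2 / 3 ^ Suc (i + m) :: real)"
      using ternary_sums[of m] by (simp add: sums_iff)
    show "norm (e (i + m) / 3 ^ Suc (i + m)) \<le> 2 / 3 ^ Suc (i + m)" for i
      using assms(1)[of "i + m"] by (simp add: divide_right_mono)
  qed
  then show ?thesis using ternary_sums[of m] unfolding eq by (simp add: sums_iff)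
qed

text \<open>Deleting the \<open>k\<close>-th term leaves a series that vanishes up to and including
  \<open>k\<close>, so the tail bound applies to it.\<close>

lemma ternary_first:
  fixes e :: "nat \<Rightarrow> real"
  assumes "\<And>i. \<bar>e i\<bar> \<le> 2" "\<And>i. i < k \<Longrightarrow> e i = 0"
  shows "\<bar>(\<Sum>i. e i / 3 ^ Suc i) - e k / 3 ^ Suc k\<bar> \<le> 1 / 3 ^ Suc k"
proof -
  define e' where "e' = e(k := 0)"
  have "\<bar>\<Sum>i. e' i / 3 ^ Suc i\<bar> \<le> 1 / 3 ^ Suc k"
    using assms by (intro ternary_bound) (auto simp: e'_def less_Suc_eq)
  moreover have "(\<lambda>i. e' i / 3 ^ Suc i) sums (\<Sum>i. e' i / 3 ^ Suc i)"
    using assms(1) by (intro summable_sums ternary_summable) (auto simp: e'_def)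
  then have "(\<lambda>i. e' i / 3 ^ Suc i + (if i = k then e i / 3 ^ Suc i else 0)) sums
      ((\<Sum>i. e' i / 3 ^ Suc i) + e k / 3 ^ Suc k)"
    using sums_single[of k "\<lambda>i. e i / 3 ^ Suc i"] by (rule sums_add)
  moreover have "(\<lambda>i. e' i / 3 ^ Suc i + (if i = k then e i / 3 ^ Suc i else 0)) = (\<lambda>i. e i / 3 ^ Suc i)"
    by (auto simp: e'_def)
  ultimately show ?thesis by (simp add: sums_iff)
qed

section \<open>The Cantor set coded by binary sequences\<close>

definition cantor_val :: "(nat \<Rightarrow> bool) \<Rightarrow> real" where
  "cantor_val a = (\<Sum>i. (if a i then 2 else 0) / 3 ^ Suc i)"

definition agree :: "nat \<Rightarrow> (nat \<Rightarrow> 'a) \<Rightarrow> (nat \<Rightarrow> 'a) \<Rightarrow> bool" where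
  "agree m u v \<longleftrightarrow> (\<forall>j<m. u j = v j)"

lemma first_difference:
  assumes "\<not> agree m u v"
  obtains k where "k < m" "agree k u v" "u k \<noteq> v k"
proof -
  define k where "k = (LEAST k. u k \<noteq> v k)"
  obtain j where "j < m" "u j \<noteq> v j" using assms by (auto simp: agree_def)
  show thesis
  proof (rule that)
    show "u k \<noteq> v k"
      unfolding k_def by (rule LeastI[of "\<lambda>k. u k \<noteq> v k"]) fact
    have "k \<le> j"
      unfolding k_def by (rule Least_le) fact
    then show "k < m" using \<open>j < m\<close> by simp
    show "agree k u v"
      unfolding agree_def k_def using not_less_Least by blast
  qed
qed

lemma cantor_val_diff:
  "cantor_val a - cantor_val b = (\<Sum>i. ((if a i then 2 else 0) - (if b i then 2 else 0)) / 3 ^ Suc i)"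
  unfolding cantor_val_def diff_divide_distrib
  by (intro suminf_diff ternary_summable) auto

lemma cantor_val_agree: "agree m a b \<Longrightarrow> \<bar>cantor_val a - cantor_val b\<bar> \<le> 1 / 3 ^ m"
  unfolding cantor_val_diff by (intro ternary_bound) (auto simp: agree_def)

text \<open>At the first difference the values are separated by \<open>2 / 3 ^ Suc k\<close>, and
  the later digits recover at most half of that.\<close>

lemma cantor_val_close:
  assumes "\<bar>cantor_val a - cantor_val b\<bar> < 1 / 3 ^ m"
  shows "agree m a b"
proof (rule ccontr)
  assume "\<not> agree m a b"
  then obtain k where k: "k < m" "agree k a b" "a k \<noteq> b k" by (rule first_difference)
  let ?e = "\<lambda>i. (if a i then 2 else 0) - (if b i then 2 else 0) :: real"
  have "\<bar>(cantor_val a - cantor_val b) - ?e k / 3 ^ Suc k\<bar> \<le> 1 / 3 ^ Suc k"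
    unfolding cantor_val_diff using k(2) by (intro ternary_first) (auto simp: agree_def)
  moreover have "\<bar>?e k / 3 ^ Suc k\<bar> = 2 / 3 ^ Suc k" using k(3) by auto
  ultimately have "1 / 3 ^ Suc k \<le> \<bar>cantor_val a - cantor_val b\<bar>" by linarith
  moreover have "(1 / 3 ^ m :: real) \<le> 1 / 3 ^ Suc k"
    using k(1) by (intro divide_left_mono power_increasing) auto
  ultimately show False using assms by linarith
qed

lemma inj_cantor_val: "inj cantor_val"
proof (rule injI, rule ext)
  fix a b :: "nat \<Rightarrow> bool" and i
  assume "cantor_val a = cantor_val b"
  then have "agree (Suc i) a b" by (intro cantor_val_close) simp
  then show "a i = b i" by (simp add: agree_def)
qed

lemma inv_cantor_val [simp]: "inv cantor_val (cantor_val a) = a"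
  using inj_cantor_val by simp

lemma cantor_set_eq: "cantor_set = range cantor_val"
  by (simp add: cantor_set_def cantor_val_def)

lemma continuous_on_cantor_digit:
  "continuous_on (range cantor_val) (\<lambda>z. of_bool (inv cantor_val z i) :: real)"
  unfolding continuous_on_iff
proof (intro ballI allI impI)
  fix z and e :: real assume z: "z \<in> range cantor_val" and "0 < e"
  have "inv cantor_val z' i = inv cantor_val z i"
    if "z' \<in> range cantor_val" "dist z' z < 1 / 3 ^ Suc i" for z'
  proof -
    have "agree (Suc i) (inv cantor_val z') (inv cantor_val z)"
      using z that by (intro cantor_val_close) (auto simp: dist_real_def)
    then show ?thesis by (simp add: agree_def)
  qed
  then show "\<exists>d>0. \<forall>z'\<in>range cantor_val. dist z' z < d \<longrightarrow>
      dist (of_bool (inv cantor_val z' i) :: real) (of_bool (inv cantor_val z i)) < e"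
    using \<open>0 < e\<close> by (intro exI[of _ "1 / 3 ^ Suc i"]) auto
qed

lemma continuous_on_cantor_map:
  assumes "\<And>m. \<exists>m'. \<forall>u\<in>A. \<forall>v\<in>A. agree m' u v \<longrightarrow> agree m (f u) (f v)"
  shows "continuous_on (cantor_val ` A) (\<lambda>z. cantor_val (f (inv cantor_val z)))"
  unfolding continuous_on_iff
proof (intro ballI allI impI)
  fix z and e :: real assume z: "z \<in> cantor_val ` A" and "0 < e"
  obtain m where m: "(1/3) ^ m < e"
    using \<open>0 < e\<close> real_arch_pow_inv[of e "1/3"] by auto
  obtain m' where m': "\<And>u v. u \<in> A \<Longrightarrow> v \<in> A \<Longrightarrow> agree m' u v \<Longrightarrow> agree m (f u) (f v)"
    using assms by blast
  have "dist (cantor_val (f (inv cantor_val z'))) (cantor_val (f (inv cantor_val z))) < e"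
    if z': "z' \<in> cantor_val ` A" "dist z' z < 1 / 3 ^ m'" for z'
  proof -
    obtain u v where uv: "u \<in> A" "v \<in> A" "z' = cantor_val u" "z = cantor_val v"
      using z z' by auto
    then have "agree m (f u) (f v)"
      using z' by (intro m' cantor_val_close) (auto simp: dist_real_def)
    from cantor_val_agree[OF this] show ?thesis
      using m uv by (simp add: dist_real_def power_divide)
  qed
  then show "\<exists>d>0. \<forall>z'\<in>cantor_val ` A. dist z' z < d \<longrightarrow>
      dist (cantor_val (f (inv cantor_val z'))) (cantor_val (f (inv cantor_val z))) < e"
    by (intro exI[of _ "1 / 3 ^ m'"]) auto
qed

text \<open>\<open>B\<close> is the set of branches of a binary tree in which the node below \<open>v\<close> at level \<open>i\<close> has
  both children if \<open>split v i\<close> and only the child \<open>True\<close> otherwise. Deleting the forced digits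
  of a branch identifies \<open>B\<close> with the full binary tree.\<close>

lemma split_tree_homeomorphic_cantor_set:
  fixes split :: "(nat \<Rightarrow> bool) \<Rightarrow> nat \<Rightarrow> bool"
  assumes local: "\<And>u v i. agree i u v \<Longrightarrow> split u i = split v i"
    and B: "B = {v. \<forall>i. \<not> split v i \<longrightarrow> v i}"
    and often: "\<And>v i. v \<in> B \<Longrightarrow> split v i \<or> split v (Suc i)"
  shows "cantor_val ` B homeomorphic cantor_set"
proof -
  \<comment> \<open>\<open>cnt v i\<close> counts the splits at levels below \<open>i\<close>;
    \<open>H v\<close> lists the digits of \<open>v\<close> at its successive splits.\<close>
  define cnt where "cnt v i = (\<Sum>j<i. of_bool (split v j) :: nat)" for v i
  define H where "H v k = v (LEAST i. split v i \<and> cnt v i = k)" for v k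
  have cnt_0 [simp]: "cnt v 0 = 0"
    and cnt_Suc [simp]: "cnt v (Suc i) = cnt v i + of_bool (split v i)" for v i
    by (simp_all add: cnt_def)
  have cnt_le: "cnt v i \<le> i" for v i
    by (induction i) (auto simp: of_bool_def)
  have cnt_mono: "cnt v i \<le> cnt v j" if "i \<le> j" for v i j
    using that by (induction j rule: dec_induct) auto
  \<comment> \<open>One split in every two levels puts the \<open>k\<close>-th split at level
    \<open>2 * k + 1\<close> at the latest. This uniform bound makes \<open>H\<close>
    continuous.\<close>
  have cnt_ge: "k \<le> cnt v (2 * k)" if "v \<in> B" for v k
  proof (induction k)
    case (Suc k)
    then show ?case using often[OF that, of "2 * k"] by (auto simp: of_bool_def)
  qed simp
  have cnt_agree: "cnt u j = cnt v j" if "agree i u v" "j \<le> i" for u v i j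
    unfolding cnt_def using that
    by (intro sum.cong arg_cong[where f = of_bool] local) (auto simp: agree_def)
  have cnt_inj: "i = j" if "split v i" "split v j" "cnt v i = cnt v j" for v i j
  proof (rule ccontr)
    assume "i \<noteq> j"
    then have "Suc i \<le> j \<or> Suc j \<le> i" by linarith
    then show False using cnt_mono[of "Suc i" j v] cnt_mono[of "Suc j" i v] that by auto
  qed
  have pos: "\<exists>i\<le>2 * k + 1. split v i \<and> cnt v i = k" if "v \<in> B" for v k
  proof -
    define i' where "i' = (LEAST i. k < cnt v i)"
    have ex: "k < cnt v (2 * Suc k)" using cnt_ge[OF that, of "Suc k"] by simp
    have i': "k < cnt v i'" "i' \<le> 2 * Suc k" "\<And>i. i < i' \<Longrightarrow> \<not> k < cnt v i"
      unfolding i'_def using ex by (rule LeastI, rule Least_le) (rule not_less_Least)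
    then obtain i where i: "i' = Suc i" by (cases i') auto
    then have "cnt v i \<le> k" using i'(3)[of i] by simp
    then have "split v i \<and> cnt v i = k" using i'(1) i by (cases "split v i") auto
    then show ?thesis using i i'(2) by (intro exI[of _ i]) auto
  qed
  have H_eq: "H v k = v i" if "split v i" "cnt v i = k" for v i k
  proof -
    have "(LEAST i. split v i \<and> cnt v i = k) = i"
    proof (rule Least_equality)
      fix j assume "split v j \<and> cnt v j = k"
      then have j: "split v j" "cnt v i = cnt v j" using that(2) by auto
      have "i = j" by (rule cnt_inj[OF that(1) j])
      then show "i \<le> j" by simp
    qed (use that in simp)
    then show ?thesis by (simp add: H_def)
  qed
  have H_agree: "agree m (H u) (H v)" if uv: "u \<in> B" "v \<in> B" "agree (2 * m + 2) u v" for u v m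
    unfolding agree_def
  proof (intro allI impI)
    fix k assume k: "k < m"
    obtain i where i: "i \<le> 2 * k + 1" "split u i" "cnt u i = k" using pos[OF uv(1)] by blast
    have "agree i u v" using uv(3) i(1) k by (auto simp: agree_def)
    then have "split v i" "cnt v i = k" using i local cnt_agree[of i u v i] by auto
    then have "H u k = u i" "H v k = v i" using H_eq i by auto
    then show "H u k = H v k" using uv(3) i(1) k by (simp add: agree_def)
  qed
  have agree_H: "agree m u v" if "u \<in> B" "v \<in> B" "agree m (H u) (H v)" for u v m
  proof (rule ccontr)
    assume "\<not> agree m u v"
    then obtain k where k: "k < m" "agree k u v" "u k \<noteq> v k" by (rule first_difference)
    have s: "split u k = split v k" using k(2) by (rule local)
    \<comment> \<open>Two branches first differ at a split, which has the same number in
      both.\<close>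
    then have sp: "split u k" "split v k" using k(3) that(1,2) B by auto
    have "H u (cnt u k) = u k" "H v (cnt u k) = v k"
      using H_eq[OF sp(1)] H_eq[OF sp(2)] cnt_agree[OF k(2)] by auto
    moreover have "cnt u k < m" using cnt_le[of u k] k(1) by simp
    ultimately show False using that(3) k(3) by (simp add: agree_def)
  qed
  have inj: "inj_on H B"
  proof (intro inj_onI ext)
    fix u v i assume "u \<in> B" "v \<in> B" "H u = H v"
    then have "agree (Suc i) u v" using agree_H[of u v "Suc i"] by (simp add: agree_def)
    then show "u i = v i" by (simp add: agree_def)
  qed
  have surj: "a \<in> H ` B" for a
  proof -
    \<comment> \<open>A branch with prescribed split digits \<open>a\<close> is built level by
      level: \<open>w i\<close> is final at levels below \<open>i\<close>, and a split takes the
      next digit of \<open>a\<close>.\<close>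
    define w where "w = rec_nat (\<lambda>_. True) (\<lambda>i v. v(i := split v i \<longrightarrow> a (cnt v i)))"
    have w_Suc: "w (Suc i) = (w i)(i := split (w i) i \<longrightarrow> a (cnt (w i) i))" for i
      by (simp add: w_def)
    have w_stable: "w (Suc j) i = w (Suc i) i" if "i \<le> j" for i j
      using that by (induction j rule: dec_induct) (simp_all add: w_Suc[of "Suc _"])
    define v where "v i = w (Suc i) i" for i
    have ag: "agree i (w i) v" for i
      unfolding agree_def v_def
    proof (intro allI impI)
      fix j assume "j < i"
      then show "w i j = w (Suc j) j" using w_stable[of j "i - 1"] by simp
    qed
    have v_eq: "v i \<longleftrightarrow> (split v i \<longrightarrow> a (cnt v i))" for i
      using local[OF ag[of i]] cnt_agree[OF ag[of i], of i] by (simp add: v_def w_Suc)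
    have vB: "v \<in> B" using v_eq by (auto simp: B)
    have "H v k = a k" for k
    proof -
      obtain i where "split v i" "cnt v i = k" using pos[OF vB] by blast
      then show ?thesis using H_eq v_eq[of i] by auto
    qed
    then show ?thesis using vB by (intro image_eqI[of _ _ v]) auto
  qed
  define G where "G = inv_into B H"
  have G: "G a \<in> B" "H (G a) = a" for a
    unfolding G_def by (rule inv_into_into[OF surj], rule f_inv_into_f[OF surj])
  have GH: "G (H v) = v" if "v \<in> B" for v
    unfolding G_def using inj that by simp
  have HB: "H ` B = UNIV" using surj by blast
  have RG: "range G = B"
  proof
    show "B \<subseteq> range G" using GH by (metis rangeI subsetI)
  qed (use G(1) in blast)
  have "homeomorphism (cantor_val ` B) (range cantor_val)
      (\<lambda>z. cantor_val (H (inv cantor_val z))) (\<lambda>z. cantor_val (G (inv cantor_val z)))"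
    unfolding homeomorphism_def
  proof (intro conjI)
    show "continuous_on (cantor_val ` B) (\<lambda>z. cantor_val (H (inv cantor_val z)))"
      using H_agree by (intro continuous_on_cantor_map) blast
    show "continuous_on (range cantor_val) (\<lambda>z. cantor_val (G (inv cantor_val z)))"
      using agree_H[OF G(1) G(1)] G(2) by (intro continuous_on_cantor_map) auto
    show "(\<lambda>z. cantor_val (H (inv cantor_val z))) ` cantor_val ` B = range cantor_val"
      using image_image[of cantor_val H B] HB by (simp add: image_image)
    show "(\<lambda>z. cantor_val (G (inv cantor_val z))) ` range cantor_val = cantor_val ` B"
      using image_image[of cantor_val G UNIV] RG by (simp add: image_image)
  qed (use G GH in auto)
  then show ?thesis unfolding cantor_set_eq homeomorphic_def by blast
qed

section \<open>Folding points\<close>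

lemma homeomorphic_Times_cong:
  assumes "A homeomorphic A'" "B homeomorphic B'"
  shows "A \<times> B homeomorphic A' \<times> B'"
proof -
  obtain f f' where f: "homeomorphism A A' f f'" using assms(1) homeomorphic_def by blast
  obtain g g' where g: "homeomorphism B B' g g'" using assms(2) homeomorphic_def by blast
  note f = f[unfolded homeomorphism_def] and g = g[unfolded homeomorphism_def]
  have cont: "continuous_on (C \<times> D) (\<lambda>q. (h (fst q), k (snd q)))"
    if "continuous_on C h" "continuous_on D k" for C D and h :: "'x::topological_space \<Rightarrow> 'y::topological_space"
      and k :: "'z::topological_space \<Rightarrow> 'w::topological_space"
    by (intro continuous_on_Pair continuous_on_compose2[OF that(1)] continuous_on_compose2[OF that(2)]
        continuous_intros) auto
  have "homeomorphism (A \<times> B) (A' \<times> B') (\<lambda>q. (f (fst q), g (snd q))) (\<lambda>q. (f' (fst q), g' (snd q)))"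
    unfolding homeomorphism_def
  proof (intro conjI)
    show "continuous_on (A \<times> B) (\<lambda>q. (f (fst q), g (snd q)))"
      "continuous_on (A' \<times> B') (\<lambda>q. (f' (fst q), g' (snd q)))"
      using f g by (auto intro!: cont)
    have "(\<lambda>q. (f (fst q), g (snd q))) ` (A \<times> B) = f ` A \<times> g ` B" by force
    then show "(\<lambda>q. (f (fst q), g (snd q))) ` (A \<times> B) = A' \<times> B'" using f g by simp
    have "(\<lambda>q. (f' (fst q), g' (snd q))) ` (A' \<times> B') = f' ` A' \<times> g' ` B'" by force
    then show "(\<lambda>q. (f' (fst q), g' (snd q))) ` (A' \<times> B') = A \<times> B" using f g by simp
  qed (use f g in auto)
  then show ?thesis unfolding homeomorphic_def by blast
qed

lemma continuous_on_cantor_val: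
  assumes "\<And>i. continuous_on A (\<lambda>x. of_bool (u x i) :: real)"
  shows "continuous_on A (\<lambda>x. cantor_val (u x))"
proof -
  have *: "(if d then 2 else 0) = 2 * (of_bool d :: real)" for d by simp
  have "uniform_limit A (\<lambda>k x. \<Sum>i<k. (if u x i then 2 else 0 :: real) / 3 ^ Suc i)
      (\<lambda>x. \<Sum>i. (if u x i then 2 else 0) / 3 ^ Suc i) sequentially"
    by (rule Weierstrass_m_test[where M = "\<lambda>i. 2 / 3 ^ Suc i :: real"])
      (use ternary_summable[of "\<lambda>_. 2"] in auto)
  then show ?thesis
    unfolding cantor_val_def
  proof (rule uniform_limit_theorem[rotated])
    show "\<forall>\<^sub>F k in sequentially. continuous_on A (\<lambda>x. \<Sum>i<k. (if u x i then 2 else 0 :: real) / 3 ^ Suc i)"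
      unfolding * by (intro always_eventually allI continuous_intros assms) auto
  qed simp
qed

section \<open>Local product structure away from the critical orbit\<close>

context tent_map
begin

lemma branch_iter:
  "(\<And>j. j < i \<Longrightarrow> branch s u y j \<in> {cr 2..cr 1}) \<Longrightarrow> (tent s ^^ i) (branch s u y i) = y"
proof (induction i)
  case (Suc i)
  have "tent s (branch s u y (Suc i)) = branch s u y i"
    using tent_preimage(1)[OF core_range[OF Suc.prems[of i]], of "u i"] by simp
  then show ?case using Suc by (simp only: funpow_Suc_right comp_apply)
qed simp

lemma continuous_on_tent_iter [continuous_intros]:
  "continuous_on A f \<Longrightarrow> continuous_on A (\<lambda>x. (tent s ^^ j) (f x))"
proof (induction j)
  case (Suc j)
  then show ?case by (auto simp: tent_def intro!: continuous_intros)
qed simp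

text \<open>While the branches avoid the critical orbit, admitting a preimage in the core does not
  depend on the point of the interval.\<close>

lemma branch_transfer:
  assumes J: "{lo<..<hi} \<inter> range cr = {}" "{lo<..<hi} \<subseteq> {cr 2..cr 1}"
    and y: "y \<in> {lo<..<hi}" "\<And>i. branch s u y i \<in> {cr 2..cr 1}"
    and z: "z \<in> {lo<..<hi}"
  shows "branch s u z i \<in> {cr 2..cr 1}"
proof -
  have "\<forall>z\<in>{lo<..<hi}. \<forall>j\<le>i. branch s u z j \<in> {cr 2..cr 1}"
  proof (induction i)
    case 0
    then show ?case using J by auto
  next
    case (Suc i)
    have "branch s u z (Suc i) \<in> {cr 2..cr 1}" if z: "z \<in> {lo<..<hi}" for z
    proof (cases "u i")
      case True
      then show ?thesis using right_preimage_core[of "branch s u z i"] Suc z by auto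
    next
      case False
      have "cr 3 \<le> branch s u z i"
      proof (rule ccontr)
        assume less: "\<not> cr 3 \<le> branch s u z i"
        have "branch s u y i / s \<in> {cr 2..cr 1}"
          using y(2)[of "Suc i"] False by simp
        then have ge: "cr 3 \<le> branch s u y i"
          using left_preimage_core y(2) by blast
        have cont: "continuous_on A (\<lambda>z. branch s u z i)" for A
          using s_gt_1 by (intro continuous_on_branch continuous_intros) auto
        have seg: "closed_segment z y \<subseteq> {lo<..<hi}"
          using y(1) z by (intro closed_segment_subset) auto
        have "connected ((\<lambda>z. branch s u z i) ` closed_segment z y)"
          by (intro connected_continuous_image cont) auto
        \<comment> \<open>By the intermediate value theorem some base point in the interval has its
          branch exactly at \<open>cr 3\<close>; iterating forward puts that base point on the
          critical orbit.\<close>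
        then obtain w where w: "w \<in> closed_segment z y" "branch s u w i = cr 3"
          using connectedD_interval[of "(\<lambda>z. branch s u z i) ` closed_segment z y"
              "branch s u z i" "branch s u y i" "cr 3"] less ge by fastforce
        have "w = (tent s ^^ i) (branch s u w i)"
          using Suc w(1) seg by (intro branch_iter[symmetric]) auto
        also have "\<dots> = cr (3 + i)" unfolding w(2) by (rule cr_add)
        finally show False using w(1) seg J(1) by auto
      qed
      moreover have "branch s u z i \<in> {cr 2..cr 1}" using Suc z by auto
      ultimately show ?thesis using left_preimage_core False by simp
    qed
    then show ?case using Suc by (auto simp: le_Suc_eq simp del: branch.simps)
  qed
  then show ?thesis using z by blast
qed

end

context tent_kneading
begin

lemma finite_critical_orbit: "finite (range cr)"
proof -
  have "cr j \<in> cr ` {..<3 + n}" for j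
  proof (cases "j < 3 + n")
    case False
    have "3 + (j - 3) mod n < 3 + n" using n_ge_1 by simp
    moreover have "cr j = cr (3 + (j - 3) mod n)"
      using False by (intro cr_mod_eq) (auto simp: mod_add_right_eq)
    ultimately show ?thesis by blast
  qed blast
  then show ?thesis by (meson finite_imageI finite_lessThan finite_subset image_subsetI)
qed

text \<open>By contraposition. Near a point with a coordinate off this orbit, a point of the core is
  determined by its \<open>M\<close>-th coordinate in an interval \<open>J\<close> and its digits
  beyond depth \<open>M\<close>; the possible digits are the same for all of \<open>J\<close>, and
  they form a Cantor set.\<close>

lemma folding_point_coords:
  assumes "folding_point s p"
  shows "p i \<in> cr ` {3..}"
proof (rule ccontr)
  assume notin: "p i \<notin> cr ` {3..}"
  have pc: "p \<in> core s" using assms by (simp add: folding_point_def)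
  \<comment> \<open>Three steps deeper the coordinate avoids the whole critical orbit, including
    \<open>cr 0\<close>, \<open>cr 1\<close> and \<open>cr 2\<close>, since these reach the orbit of
    \<open>cr 3\<close> within three iterates.\<close>
  define M where "M = i + 3"
  have "p M \<notin> range cr"
  proof
    assume "p M \<in> range cr"
    then obtain j where "p M = cr j" by blast
    then have "p i = cr (j + 3)"
      using core_iter[OF pc, of 3 i] cr_add[of 3 j] by (simp add: M_def)
    then show False using notin by simp
  qed
  moreover have "open (- range cr)"
    using finite_imp_closed[OF finite_critical_orbit] by (rule open_Compl)
  ultimately obtain e where e: "0 < e" "ball (p M) e \<subseteq> - range cr"
    by (meson ComplI open_contains_ball)
  define lo hi where "lo = p M - e" and "hi = p M + e"
  define J where "J = {lo<..<hi}"
  have pJ: "p M \<in> J" using e by (simp add: J_def lo_def hi_def)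
  have Jcr: "J \<inter> range cr = {}"
  proof -
    have "J = ball (p M) e" by (auto simp: J_def lo_def hi_def dist_real_def)
    then show ?thesis using e(2) by blast
  qed
  have Jcore: "J \<subseteq> {cr 2..cr 1}"
  proof
    fix y assume y: "y \<in> J"
    have pM: "p M \<in> {cr 2..cr 1}" using core_mem[OF pc] .
    have "cr 2 \<notin> J" "cr 1 \<notin> J" using Jcr by blast+
    then show "y \<in> {cr 2..cr 1}"
      using y pM pJ unfolding J_def greaterThanLessThan_iff atLeastAtMost_iff by linarith
  qed
  \<comment> \<open>Digit 0 is available where the branch is at least \<open>cr 3\<close>. The
    inequality can be strict because core branches based in \<open>J\<close> never meet
    \<open>cr 3\<close>.\<close>
  define split where "split v k \<longleftrightarrow> cr 3 < branch s v (p M) k" for v k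
  define B where "B = {v. \<forall>k. \<not> split v k \<longrightarrow> v k}"
  have B_core: "branch s v (p M) k \<in> {cr 2..cr 1}" if "v \<in> B" for v k
  proof (induction k)
    case 0
    then show ?case using core_mem[OF pc] by simp
  next
    case (Suc k)
    show ?case
    proof (cases "v k")
      case True
      then show ?thesis using right_preimage_core[OF Suc] by simp
    next
      case False
      then have "cr 3 < branch s v (p M) k" using that unfolding B_def split_def by blast
      then have "cr 3 \<le> branch s v (p M) k" by (rule less_imp_le)
      then show ?thesis using left_preimage_core[OF Suc] False by simp
    qed
  qed
  have transfer: "branch s v z k \<in> {cr 2..cr 1}"
    if "y \<in> J" "z \<in> J" "\<And>k. branch s v y k \<in> {cr 2..cr 1}" for v y z k
    using branch_transfer[of lo hi y v z k] Jcr Jcore that unfolding J_def by blast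
  have ne_orbit: "branch s v y k \<noteq> cr j"
    if "y \<in> J" "\<And>k. branch s v y k \<in> {cr 2..cr 1}" for v y k j
  proof
    assume "branch s v y k = cr j"
    then have "y = cr (j + k)"
      using branch_iter[of k v y] that(2) cr_add[of k j] by simp
    then show False using that(1) Jcr by blast
  qed
  have core_B: "v \<in> B" if "\<And>k. branch s v (p M) k \<in> {cr 2..cr 1}" for v
    unfolding B_def mem_Collect_eq split_def
  proof (intro allI impI)
    fix k assume "\<not> cr 3 < branch s v (p M) k"
    moreover have "branch s v (p M) k \<noteq> cr 3" using ne_orbit[OF pJ that] .
    ultimately have "\<not> branch s v (p M) k / s \<in> {cr 2..cr 1}"
      using left_preimage_core[OF that[of k]] by linarith
    then show "v k" using that[of "Suc k"] by (cases "v k") auto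
  qed
  have B_iff: "v \<in> B \<longleftrightarrow> (\<forall>k. branch s v y k \<in> {cr 2..cr 1})" if "y \<in> J" for v y
    using transfer[OF that pJ] transfer[OF pJ that] B_core core_B by blast
  have tree: "cantor_val ` B homeomorphic cantor_set"
  proof (rule split_tree_homeomorphic_cantor_set[OF _ B_def])
    show "split u k = split v k" if "agree k u v" for u v k
      using branch_cong[of k u v] that by (simp add: split_def agree_def)
    show "split v k \<or> split v (Suc k)" if "v \<in> B" for v k
    proof (rule disjCI)
      \<comment> \<open>A level without a split forces digit 1, and the next coordinate is then at
        least \<open>1 - cr 2\<close>, which exceeds \<open>cr 3\<close>.\<close>
      assume ns: "\<not> split v (Suc k)"
      show "split v k"
      proof (rule ccontr)
        assume "\<not> split v k"
        then have "v k" "branch s v (p M) k \<le> cr 3"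
          using that unfolding B_def split_def not_less by blast+
        then have "branch s v (p M) (Suc k) \<ge> 1 - cr 3 / s"
          using s_gt_1 by (simp add: divide_right_mono)
        then have "branch s v (p M) (Suc k) \<ge> 1 - cr 2" using s_gt_1 by (simp add: cr3)
        then show False using ns cr2_cr3 unfolding split_def by linarith
      qed
    qed
  qed
  define N where "N = {x \<in> core s. x M \<in> J}"
  define dg where "dg x k \<longleftrightarrow> 1/2 \<le> x (Suc (M + k))" for x :: "nat \<Rightarrow> real" and k
  define ext where "ext v y j = (if j < M then (tent s ^^ (M - j)) y else branch s v y (j - M))" for v y j
  have dg: "x (Suc (M + k)) \<in> side (dg x k)" if "x \<in> core s" for x k
    using side_cases[OF core_unit[OF core_mem[OF that, of "Suc (M + k)"]]] by (simp add: dg_def)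
  have x_branch: "x (M + k) = branch s (dg x) (x M) k" if "x \<in> core s" for x k
    using core_eq_branch[OF that dg[OF that]] .
  have dg_B: "dg x \<in> B" if "x \<in> N" for x
  proof -
    have x: "x \<in> core s" "x M \<in> J" using that by (auto simp: N_def)
    have "branch s (dg x) (x M) k \<in> {cr 2..cr 1}" for k
      using core_mem[OF x(1), of "M + k"] unfolding x_branch[OF x(1)] .
    then show ?thesis using B_iff[OF x(2)] by blast
  qed
  have ext_N: "ext v y \<in> N" and dg_ext: "dg (ext v y) = v" and ext_M: "ext v y M = y"
    if v: "v \<in> B" and y: "y \<in> J" for v y
  proof -
    have br: "branch s v y k \<in> {cr 2..cr 1}" for k using B_iff v y by blast
    show M: "ext v y M = y" by (simp add: ext_def)
    have "tent s (ext v y (Suc j)) = ext v y j" for j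
    proof (cases "Suc j \<le> M")
      case True
      then have "M - j = Suc (M - Suc j)" by simp
      then show ?thesis using True by (auto simp: ext_def)
    next
      case False
      then show ?thesis
        using core_tent[OF branch_core(1)[OF br], of "j - M"] by (simp add: ext_def Suc_diff_le)
    qed
    moreover have "ext v y j \<in> {cr 2..cr 1}" for j
      using br tent_iter_core[of y] y Jcore unfolding ext_def by auto
    ultimately show N: "ext v y \<in> N" using M y by (simp add: N_def core_iff)
    show "dg (ext v y) = v"
    proof
      fix k
      have "branch s v y (Suc k) \<noteq> cr 0" by (rule ne_orbit[OF y br])
      then show "dg (ext v y) k = v k"
        using branch_core(2)[OF br, of k] by (auto simp: dg_def ext_def side_def split: if_splits)
    qed
  qed
  have ext_dg: "ext (dg x) (x M) = x" if "x \<in> N" for x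
  proof
    fix j
    show "ext (dg x) (x M) j = x j"
    proof (cases "j < M")
      case True
      then show ?thesis using core_iter[of x "M - j" j] that by (simp add: ext_def N_def)
    next
      case False
      then show ?thesis using x_branch[of x "j - M"] that by (simp add: ext_def N_def)
    qed
  qed
  have cont_dg: "continuous_on N (\<lambda>x. of_bool (dg x k) :: real)" for k
  proof -
    have ne: "x (Suc (M + k)) \<noteq> 1/2" if "x \<in> N" for x
      using ne_orbit[of "x M" "dg x" "Suc k" 0] x_branch[of x] core_mem[of x] that
      unfolding N_def by (metis (no_types, lifting) add_Suc_right funpow_0 mem_Collect_eq)
    \<comment> \<open>These coordinates never equal \<open>1/2\<close>, so the digit is a continuous
      function, written with \<open>sgn\<close>.\<close>
    have "continuous_on N (\<lambda>x. (1 + sgn (x (Suc (M + k)) - 1/2)) / 2)"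
      using ne by (intro continuous_intros continuous_on_subset[OF continuous_on_product_coordinates]) auto
    moreover have "(1 + sgn (x (Suc (M + k)) - 1/2)) / 2 = of_bool (dg x k)" if "x \<in> N" for x
      using ne[OF that] by (auto simp: dg_def sgn_if)
    ultimately show ?thesis by (simp cong: continuous_on_cong)
  qed
  have "homeomorphism N (cantor_val ` B \<times> J) (\<lambda>x. (cantor_val (dg x), x M))
      (\<lambda>q. ext (inv cantor_val (fst q)) (snd q))"
    unfolding homeomorphism_def
  proof (intro conjI)
    show "continuous_on N (\<lambda>x. (cantor_val (dg x), x M))"
      by (intro continuous_on_Pair continuous_on_cantor_val cont_dg
          continuous_on_subset[OF continuous_on_product_coordinates]) auto
    have digit: "continuous_on (cantor_val ` B \<times> J) (\<lambda>q. of_bool (inv cantor_val (fst q) k) :: real)" for k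
      by (rule continuous_on_compose2[OF continuous_on_cantor_digit]) (auto intro!: continuous_intros)
    show "continuous_on (cantor_val ` B \<times> J) (\<lambda>q. ext (inv cantor_val (fst q)) (snd q))"
    proof (rule continuous_on_coordinatewise_then_product)
      fix j
      show "continuous_on (cantor_val ` B \<times> J) (\<lambda>q. ext (inv cantor_val (fst q)) (snd q) j)"
        unfolding ext_def using s_gt_1
        by (cases "j < M") (auto intro!: continuous_intros continuous_on_branch digit simp del: of_bool_eq_iff)
    qed
    show "(\<lambda>x. (cantor_val (dg x), x M)) ` N = cantor_val ` B \<times> J"
    proof
      show "(\<lambda>x. (cantor_val (dg x), x M)) ` N \<subseteq> cantor_val ` B \<times> J"
        using dg_B by (auto simp: N_def)
      show "cantor_val ` B \<times> J \<subseteq> (\<lambda>x. (cantor_val (dg x), x M)) ` N"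
      proof
        fix q assume "q \<in> cantor_val ` B \<times> J"
        then obtain v where "v \<in> B" "snd q \<in> J" "fst q = cantor_val v" by auto
        then show "q \<in> (\<lambda>x. (cantor_val (dg x), x M)) ` N"
          using ext_N dg_ext ext_M by (intro image_eqI[of _ _ "ext v (snd q)"]) (auto simp: prod_eq_iff)
      qed
    qed
    show "(\<lambda>q. ext (inv cantor_val (fst q)) (snd q)) ` (cantor_val ` B \<times> J) = N"
    proof
      show "(\<lambda>q. ext (inv cantor_val (fst q)) (snd q)) ` (cantor_val ` B \<times> J) \<subseteq> N"
        using ext_N by auto
      show "N \<subseteq> (\<lambda>q. ext (inv cantor_val (fst q)) (snd q)) ` (cantor_val ` B \<times> J)"
      proof
        fix x assume "x \<in> N"
        then show "x \<in> (\<lambda>q. ext (inv cantor_val (fst q)) (snd q)) ` (cantor_val ` B \<times> J)"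
          using ext_dg dg_B by (intro image_eqI[of _ _ "(cantor_val (dg x), x M)"]) (auto simp: N_def)
      qed
    qed
  qed (use ext_dg dg_ext ext_M in auto)
  then have "N homeomorphic cantor_val ` B \<times> J" unfolding homeomorphic_def by blast
  moreover have "J homeomorphic (UNIV :: real set)"
    unfolding J_def by (rule homeomorphic_open_interval_UNIV) (use e(1) in \<open>simp add: lo_def hi_def\<close>)
  then have "J homeomorphic {0<..<1::real}"
    using homeomorphic_open_interval_UNIV[of 0 "1::real"] homeomorphic_trans homeomorphic_sym
    by (metis zero_less_one)
  then have "cantor_val ` B \<times> J homeomorphic cantor_set \<times> {0<..<1::real}"
    by (intro homeomorphic_Times_cong tree)
  ultimately have "N homeomorphic cantor_set \<times> {0<..<1::real}"
    by (rule homeomorphic_trans)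
  moreover have "openin (top_of_set (core s)) N"
  proof -
    have "open ((\<lambda>x :: nat \<Rightarrow> real. x M) -` J)"
      unfolding J_def by (intro open_vimage open_greaterThanLessThan continuous_on_product_coordinates)
    moreover have "N = core s \<inter> (\<lambda>x. x M) -` J" by (auto simp: N_def)
    ultimately show ?thesis by (metis openin_open_Int)
  qed
  moreover have "p \<in> N" "N \<subseteq> core s" using pc pJ by (auto simp: N_def)
  ultimately show False using assms unfolding folding_point_def by blast
qed

end

section \<open>The vertical order of the basic arcs\<close>

text \<open>The sign of the \<open>k\<close>-th ternary term of \<open>psi\<close>; the sum of the
  two counts has the parity of their difference.\<close>

definition height_sign :: "(nat \<Rightarrow> bool) \<Rightarrow> (nat \<Rightarrow> bool) \<Rightarrow> nat \<Rightarrow> real" where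
  "height_sign L u k = (-1) ^ (ones (left_word L (Suc k)) + ones (left_word u (Suc k)))"

lemma height_sign_cases: "height_sign L u k = 1 \<or> height_sign L u k = -1"
  by (cases "even (ones (left_word L (Suc k)) + ones (left_word u (Suc k)))")
    (auto simp: height_sign_def)

lemma agree_sym: "agree m u v \<Longrightarrow> agree m v u"
  and agree_mono: "agree m u v \<Longrightarrow> k \<le> m \<Longrightarrow> agree k u v"
  by (auto simp: agree_def)

lemma left_word_agree: "agree k u v \<Longrightarrow> left_word u k = left_word v k"
  by (intro left_word_cong) (simp add: agree_def)

lemma height_sign_agree: "agree (Suc k) u v \<Longrightarrow> height_sign L u k = height_sign L v k"
  by (simp add: height_sign_def left_word_agree)

lemma height_sign_first_difference:
  "agree k u v \<Longrightarrow> u k \<noteq> v k \<Longrightarrow> height_sign L v k = - height_sign L u k"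
  by (auto simp: height_sign_def left_word_Suc left_word_agree)

lemma psi_eq: "psi L u = (\<Sum>i. height_sign L u i / 3 ^ Suc i) + 1/2"
proof -
  have "(-1) powi (int a - int b) = ((-1) ^ (a + b) :: real)" for a b
    by (cases "even a"; cases "even b") (simp_all add: power_int_diff)
  then show ?thesis unfolding psi_def height_sign_def by simp
qed

lemma height_sign_summable: "summable (\<lambda>i. height_sign L u i / 3 ^ Suc i)"
  using height_sign_cases[of L u] by (intro ternary_summable) (smt (verit))

lemma psi_diff:
  "psi L v - psi L u = (\<Sum>i. (height_sign L v i - height_sign L u i) / 3 ^ Suc i)"
  unfolding psi_eq diff_divide_distrib
  using suminf_diff[OF height_sign_summable height_sign_summable, of L v L u] by simp

lemma height_sign_diff_le: "\<bar>height_sign L v i - height_sign L u i\<bar> \<le> 2"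
  using height_sign_cases[of L u i] height_sign_cases[of L v i] by auto

lemma psi_agree: "agree m u v \<Longrightarrow> \<bar>psi L v - psi L u\<bar> \<le> 1 / 3 ^ m"
  unfolding psi_diff using height_sign_agree[of _ u v L]
  by (intro ternary_bound height_sign_diff_le) (simp add: agree_def)

lemma psi_first_difference:
  assumes "agree k u v" "u k \<noteq> v k"
  shows "\<bar>psi L v - psi L u + 2 * height_sign L u k / 3 ^ Suc k\<bar> \<le> 1 / 3 ^ Suc k"
proof -
  have "\<bar>psi L v - psi L u - (height_sign L v k - height_sign L u k) / 3 ^ Suc k\<bar> \<le> 1 / 3 ^ Suc k"
    unfolding psi_diff using height_sign_agree[of _ u v L] assms(1)
    by (intro ternary_first height_sign_diff_le) (simp add: agree_def)
  then show ?thesis using height_sign_first_difference[OF assms, of L] by simp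
qed

lemma left_less_iff:
  assumes "agree k u v" "u k \<noteq> v k"
  shows "left_less L v u \<longleftrightarrow> height_sign L u k = 1"
proof -
  have "(\<forall>j<k'. v j = u j) \<and> v k' \<noteq> u k' \<longleftrightarrow> k' = k" for k'
    using assms unfolding agree_def by (metis linorder_neqE_nat)
  then have "left_less L v u \<longleftrightarrow>
      (u k = L k \<and> even (int (ones (left_word v k)) - int (ones (left_word L k)))) \<or>
      (v k = L k \<and> odd (int (ones (left_word v k)) - int (ones (left_word L k))))"
    unfolding left_less_def conj_assoc[symmetric] by auto
  also have "left_word v k = left_word u k" using left_word_agree[OF assms(1)] by simp
  finally show ?thesis
    using assms(2) by (cases "L k"; cases "u k") (auto simp: height_sign_def left_word_Suc uminus_power_if)
qed

text \<open>Deviations below the length of the word stay in its cylinder, and the two signs place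
  them on opposite vertical sides of \<open>u\<close>.\<close>

lemma not_cylinder_extremum:
  assumes "\<And>m e. e \<in> {1, -1} \<Longrightarrow>
      \<exists>k\<ge>m. height_sign L u k = e \<and> (\<exists>v. left_adm_core s v \<and> agree k u v \<and> u k \<noteq> v k)"
  shows "\<not> cylinder_extremum s L u"
proof
  assume "cylinder_extremum s L u"
  then obtain w where u: "u \<in> cylinder s w"
    and "(\<forall>v\<in>cylinder s w. v = u \<or> left_less L v u) \<or> (\<forall>v\<in>cylinder s w. v = u \<or> left_less L u v)"
    by (auto simp: cylinder_extremum_def)
  moreover have "\<exists>v\<in>cylinder s w. v \<noteq> u \<and> (left_less L v u \<longleftrightarrow> e = 1) \<and> (left_less L u v \<longleftrightarrow> e = -1)"
    if e: "e \<in> {1, -1 :: real}" for e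
  proof -
    obtain k v where k: "length w \<le> k" "height_sign L u k = e"
      and v: "left_adm_core s v" "agree k u v" "u k \<noteq> v k"
      using assms[OF e, of "length w"] by blast
    have "left_word v (length w) = left_word u (length w)"
      using agree_mono[OF v(2) k(1)] by (simp add: left_word_agree)
    then have "v \<in> cylinder s w" using u v(1) by (simp add: cylinder_def)
    moreover have "left_less L v u \<longleftrightarrow> e = 1" using left_less_iff[OF v(2,3)] k(2) by simp
    moreover have "left_less L u v \<longleftrightarrow> e = -1"
      using left_less_iff[OF agree_sym[OF v(2)] v(3)[symmetric], of L] k(2) e
        height_sign_first_difference[OF v(2,3), of L] by auto
    moreover have "v \<noteq> u" using v(3) by auto
    ultimately show ?thesis by metis
  qed
  from this[of 1] this[of "-1"] show False
    using calculation by (smt (verit) insertI1 insertI2)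
qed

section \<open>Type 3 folding points\<close>

lemma nth_kneading_word: "i < m \<Longrightarrow> kneading_word s j m ! i = kneading s (j + i)"
  by (simp add: kneading_word_def)

context tent_kneading
begin

text \<open>When \<open>x k\<close> is at least \<open>cr 3\<close>, both of its preimages lie in
  the core. The digit can be flipped there and continued by digits 1, which are always
  possible.\<close>

lemma deviation_exists:
  assumes x: "x \<in> core s" "\<And>i. x (Suc i) \<in> side (u i)" and k: "cr 3 \<le> x k"
  obtains v where "left_adm_core s v" "agree k u v" "u k \<noteq> v k"
proof -
  define v where "v j = (if j < k then u j else if j = k then \<not> u k else True)" for j
  have br: "branch s v (x 0) i = x i" if "i \<le> k" for i
  proof -
    have "branch s v (x 0) i = branch s u (x 0) i"
      using that by (intro branch_cong) (simp add: v_def)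
    then show ?thesis using core_eq_branch[OF x(1), of 0 u i] x(2) by simp
  qed
  have "branch s v (x 0) i \<in> {cr 2..cr 1}" for i
  proof (induction i)
    case 0
    then show ?case using core_mem[OF x(1)] by simp
  next
    case (Suc i)
    consider "Suc i \<le> k" | "i = k" | "k < i" by linarith
    then show ?case
    proof cases
      case 1
      then show ?thesis using br[OF 1] core_mem[OF x(1)] by metis
    next
      case 2
      then have "branch s v (x 0) i = x k" using br by simp
      then show ?thesis
        using right_preimage_core[OF Suc] left_preimage_core[OF Suc] k by simp
    next
      case 3
      then show ?thesis using right_preimage_core[OF Suc] by (simp add: v_def)
    qed
  qed
  note c = branch_core[OF this]
  have "left_adm_core s v"
    by (rule left_adm_core_of_core[OF c(1), of 0]) (simp only: add_0 c(2))
  then show thesis using that[of v] by (auto simp: v_def agree_def)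
qed

end

text \<open>The phase \<open>k0\<close> locates \<open>p\<close> on the periodic orbit: at the
  depths congruent to \<open>k0\<close> modulo \<open>n\<close>, the folds, the coordinate is
  \<open>cr 3\<close>.\<close>

locale periodic_point = tent_kneading +
  fixes p :: "nat \<Rightarrow> real" and k0 :: nat
  assumes p_core: "p \<in> core s" and p_orbit: "\<And>i. p i \<in> cr ` {3..}"
    and k0_less: "k0 < n" and p_0: "p 0 = cr (k0 + 3)"
begin

definition P :: "nat \<Rightarrow> bool" where
  "P k \<longleftrightarrow> 1/2 \<le> p (Suc k)"

text \<open>\<open>L\<close> is the tail \<open>(1 0 c\<^sub>3 \<dots> c\<^sub>n)\<^sup>\<infinity>\<close> aligned with \<open>P\<close>: at the depths \<open>k0\<close> and \<open>k0 + 1\<close>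
  modulo \<open>n\<close>, where \<open>P\<close> has the digits \<open>c\<^bsub>n+2\<^esub> = 1\<close> and \<open>c\<^bsub>n+1\<^esub> = 0\<close>, it has \<open>0\<close> and \<open>1\<close>;
  elsewhere the two agree.\<close>

definition L :: "nat \<Rightarrow> bool" where
  "L j = left_cycle ([True, False] @ kneading_word s 3 (n - 2)) (j + (2 * n - 2 - k0))"

text \<open>On the periodic orbit, \<open>i\<close> steps backward are the same as
  \<open>(n - 1) * i\<close> steps forward, so \<open>p i\<close> is determined by
  \<open>p 0\<close>.\<close>

lemma p_eq_cr:
  assumes "3 \<le> m" "(m + i) mod n = (k0 + 3) mod n"
  shows "p i = cr m"
proof -
  obtain j where j: "3 \<le> j" "p i = cr j" using p_orbit by auto
  have "p i = cr (j + i * n)" using cr_period_mult[OF j(1)] j(2) by simp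
  also have "j + i * n = (j + i) + (n - 1) * i"
    using n_ge_1 by (cases n) auto
  also have "cr \<dots> = (tent s ^^ ((n - 1) * i)) (cr (j + i))" by (rule cr_add[symmetric])
  also have "cr (j + i) = p 0" using core_iter[OF p_core, of i 0] cr_add[of i j] j(2) by simp
  also have "(tent s ^^ ((n - 1) * i)) (p 0) = cr (k0 + 3 + (n - 1) * i)"
    unfolding p_0 by (rule cr_add)
  also have "\<dots> = cr m"
  proof (rule cr_mod_eq)
    have "(k0 + 3 + (n - 1) * i) mod n = (m + i + (n - 1) * i) mod n"
      using assms(2) by (metis mod_add_left_eq)
    also have "m + i + (n - 1) * i = m + n * i"
      using n_ge_1 by (cases n) auto
    finally show "(k0 + 3 + (n - 1) * i) mod n = m mod n" by simp
  qed (use assms in auto)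
  finally show ?thesis .
qed

lemma p_side: "p (Suc i) \<in> side (P i)"
  using side_cases[OF core_unit[OF core_mem[OF p_core]]] by (simp add: P_def)

lemma P_eq:
  assumes "3 \<le> m" "(m + Suc i) mod n = (k0 + 3) mod n"
  shows "P i = kneading s m"
  using p_eq_cr[OF assms] by (simp add: P_def kneading_eq)

lemma p_at_fold:
  assumes "k mod n = k0"
  shows "p k = cr 3" "P k"
proof -
  have *: "(3 + k) mod n = (k0 + 3) mod n"
    using assms k0_less by (metis add.commute mod_add_left_eq)
  then show "p k = cr 3" by (intro p_eq_cr) auto
  have "n + 2 + Suc k = n + (3 + k)" by simp
  then have "(n + 2 + Suc k) mod n = (k0 + 3) mod n"
    using * unfolding mod_add_self1 by (simp only: mod_add_self1)
  then show "P k" using P_eq[of "n + 2" k] n_ge_1 k_n2 by simp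
qed

lemma p_after_fold:
  assumes "k mod n = (k0 + 1) mod n"
  shows "p k = cr (n + 2)" "\<not> P k"
proof -
  have "(2 + k) mod n = (2 + (k0 + 1)) mod n"
    using assms by (rule mod_add_cong[OF refl])
  then have *: "(2 + k) mod n = (k0 + 3) mod n" by (simp add: numeral_3_eq_3)
  have "(n + 2 + k) mod n = (k0 + 3) mod n"
    unfolding add.assoc mod_add_self1 by (rule *)
  then show "p k = cr (n + 2)" using n_ge_1 by (intro p_eq_cr) auto
  have "(n + 1 + Suc k) mod n = (n + (2 + k)) mod n" by simp
  also have "\<dots> = (k0 + 3) mod n" unfolding mod_add_self1 by (rule *)
  finally show "\<not> P k" using P_eq[of "n + 1" k] n_ge_2 k_n1 by simp
qed

lemma left_cycle_eq:
  "left_cycle ([True, False] @ kneading_word s 3 (n - 2)) i =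
     (if i mod n = n - 1 then True else if i mod n = n - 2 then False else kneading s (n - i mod n))"
proof -
  define W where "W = [True, False] @ kneading_word s 3 (n - 2)"
  define r where "r = i mod n"
  have "length W = 2 + (n - 2)" by (simp add: W_def kneading_word_def)
  then have len: "length W = n" using n_ge_2 by linarith
  have r: "r < n" using n_ge_1 by (simp add: r_def)
  have "left_cycle W i = rev W ! r"
    unfolding left_cycle_def cycle_seq_def length_rev len r_def ..
  also have "\<dots> = W ! (n - Suc r)"
    using rev_nth[of r W] r unfolding len by blast
  also have "\<dots> = (if r = n - 1 then True else if r = n - 2 then False else kneading s (n - r))"
  proof -
    consider "r = n - 1" | "r = n - 2" "r \<noteq> n - 1" | "r < n - 2"
      using r by linarith
    then show ?thesis
    proof cases
      case 1
      then have "n - Suc r = 0" by linarith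
      then show ?thesis using 1 by (simp add: W_def)
    next
      case 2
      then have "n - Suc r = 1" using r n_ge_2 by linarith
      then show ?thesis using 2 by (simp add: W_def)
    next
      case 3
      define q where "q = n - 3 - r"
      have q: "n - Suc r = Suc (Suc q)" "n - r = 3 + q" "q < n - 2"
        using 3 unfolding q_def by linarith+
      have "W ! (n - Suc r) = kneading s (n - r)"
        unfolding q(1,2) using q(3) by (simp add: W_def nth_kneading_word)
      moreover have "r \<noteq> n - 1" "r \<noteq> n - 2" using 3 by linarith+
      ultimately show ?thesis by simp
    qed
  qed
  finally show ?thesis unfolding W_def r_def .
qed

lemma L_P:
  "int (of_bool (P k)) - int (of_bool (L k)) =
     of_bool (k mod n = k0) - of_bool (k mod n = (k0 + 1) mod n)"
proof -
  \<comment> \<open>The position in the cycle after the shift, which is \<open>n - 2 - k0\<close>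
    modulo \<open>n\<close>; the extra \<open>n\<close> keeps the subtraction from truncating when
    \<open>k0 = n - 1\<close>.\<close>
  define q where "q = (k + (2 * n - 2 - k0)) mod n"
  have q: "q < n" using n_ge_1 by (simp add: q_def)
  have le: "k0 + 2 \<le> 2 * n" using k0_less n_ge_2 by simp
  have q1: "(q + (k0 + 2)) mod n = k mod n"
  proof -
    have "(q + (k0 + 2)) mod n = (k + (2 * n - 2 - k0) + (k0 + 2)) mod n"
      unfolding q_def by (rule mod_add_left_eq)
    also have "k + (2 * n - 2 - k0) + (k0 + 2) = k + 2 * n" using le by simp
    finally show ?thesis by simp
  qed
  have L: "L k = (if q = n - 1 then True else if q = n - 2 then False else kneading s (n - q))"
    unfolding L_def left_cycle_eq q_def ..
  have ne: "k0 \<noteq> (k0 + 1) mod n" using k0_less n_ge_2 by (simp add: mod_Suc)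
  consider (a) "q = n - 1" | (b) "q = n - 2" | (c) "q < n - 2" using q n_ge_2 by linarith
  then show ?thesis
  proof cases
    case a
    then have "q + (k0 + 2) = n + (k0 + 1)" using n_ge_2 by linarith
    then have "k mod n = (n + (k0 + 1)) mod n" using q1 by metis
    then have "k mod n = (k0 + 1) mod n" unfolding mod_add_self1 .
    then show ?thesis using p_after_fold(2)[of k] L a ne by auto
  next
    case b
    then have "q + (k0 + 2) = n + k0" using n_ge_2 by linarith
    then have "k mod n = (n + k0) mod n" using q1 by metis
    then have "k mod n = k0" using k0_less by simp
    moreover have "q \<noteq> n - 1" using b n_ge_2 by simp
    ultimately show ?thesis using p_at_fold(2)[of k] L b ne by auto
  next
    case c
    have "(n - q + Suc k) mod n = (k0 + 3) mod n"
    proof -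
      have "(n - q + Suc k) mod n = (Suc (n - q) + k) mod n" by simp
      also have "\<dots> = (Suc (n - q) + (q + (k0 + 2))) mod n"
        using q1 by (intro mod_add_cong) auto
      also have "Suc (n - q) + (q + (k0 + 2)) = n + (k0 + 3)" using q by simp
      finally show ?thesis by simp
    qed
    then have "P k = kneading s (n - q)" using c by (intro P_eq) auto
    then have PL: "P k = L k" using L c by auto
    have mod_eq: "m mod n = (if m < n then m else m - n)" if "m < 2 * n" for m
      using that by (cases "m < n") (simp_all add: le_mod_geq)
    have "k mod n \<noteq> k0" "k mod n \<noteq> (k0 + 1) mod n"
      using c k0_less mod_eq[of "q + (k0 + 2)"] mod_eq[of "k0 + 1"] q1
      by (auto split: if_splits)
    then show ?thesis using PL by simp
  qed
qed

text \<open>Each exchange of two adjacent digits changes the count only between its two depths. If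
  \<open>k0 = n - 1\<close>, depth 0 is already the second half of an exchange, which leaves a
  constant offset.\<close>

lemma ones_left_word_P_L:
  "int (ones (left_word P (Suc k))) - int (ones (left_word L (Suc k))) =
     of_bool (k mod n = k0) - of_bool (k0 = n - 1)"
proof (induction k)
  have ones_Suc: "int (ones (left_word u (Suc k))) = int (of_bool (u k)) + int (ones (left_word u k))" for u k
    by (simp add: left_word_Suc)
  {
    case 0
    have "0 mod n = (k0 + 1) mod n \<longleftrightarrow> k0 = n - 1"
      using k0_less n_ge_2 by (auto simp: mod_Suc)
    then show ?case using L_P[of 0] unfolding ones_Suc by (simp only: left_word_0 ones_Nil)
  next
    case (Suc k)
    have "Suc k mod n = (k0 + 1) mod n \<longleftrightarrow> k mod n = k0"
      using k0_less n_ge_2 by (auto simp: mod_Suc)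
    then have "int (of_bool (P (Suc k))) - int (of_bool (L (Suc k))) =
        of_bool (Suc k mod n = k0) - of_bool (k mod n = k0)"
      using L_P[of "Suc k"] by (simp only:)
    then show ?case using Suc ones_Suc[of P "Suc k"] ones_Suc[of L "Suc k"] by linarith
  }
qed

end

lemma left_word_add: "left_word u (k + m) = left_word (\<lambda>i. u (k + i)) m @ left_word u k"
  by (induction m) (simp_all add: left_word_Suc)

lemma height_sign_Suc:
  "height_sign L u (Suc k) = height_sign L u k * (-1) ^ (of_bool (L (Suc k)) + of_bool (u (Suc k)))"
  unfolding height_sign_def left_word_Suc[of _ "Suc k"] by (cases "L (Suc k)"; cases "u (Suc k)") simp_all

context periodic_point
begin

text \<open>The vertical side of \<open>p\<close>, \<open>1\<close> for above and \<open>-1\<close>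
  for below, on which the sequences leaving at a fold are drawn.\<close>

definition sgm :: real where
  "sgm = (if k0 = n - 1 then -1 else 1)"

lemma sgm_cases: "sgm = 1 \<or> sgm = -1"
  by (simp add: sgm_def)

lemma height_sign_P: "height_sign L P k = (if k mod n = k0 then - sgm else sgm)"
proof -
  have "even (ones (left_word L (Suc k)) + ones (left_word P (Suc k))) \<longleftrightarrow>
      even (int (ones (left_word P (Suc k))) - int (ones (left_word L (Suc k))))"
    by auto
  also have "\<dots> \<longleftrightarrow> (k mod n = k0) = (k0 = n - 1)"
    unfolding ones_left_word_P_L by (simp add: of_bool_def)
  finally show ?thesis
    unfolding height_sign_def sgm_def by (auto simp: uminus_power_if)
qed

lemma fold_word:
  assumes "k mod n = k0"
  shows "left_word (\<lambda>i. P (k + i)) n = kneading_word s 3 n"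
proof (rule nth_equalityI)
  show "length (left_word (\<lambda>i. P (k + i)) n) = length (kneading_word s 3 n)"
    by (simp add: kneading_word_def)
  fix i assume "i < length (left_word (\<lambda>i. P (k + i)) n)"
  then have i: "i < n" by simp
  then have "left_word (\<lambda>i. P (k + i)) n ! i = P (k + (n - Suc i))"
    by (simp add: left_word_def rev_nth)
  also have "\<dots> = kneading s (3 + i)"
  proof (rule P_eq)
    have "3 + i + Suc (k + (n - Suc i)) = n + (3 + k)" using i by simp
    then have "(3 + i + Suc (k + (n - Suc i))) mod n = (3 + k) mod n" by (simp only: mod_add_self1)
    also have "\<dots> = (k0 + 3) mod n" using assms by (metis add.commute mod_add_left_eq)
    finally show "(3 + i + Suc (k + (n - Suc i))) mod n = (k0 + 3) mod n" .
  qed simp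
  also have "\<dots> = kneading_word s 3 n ! i" using i by (simp add: nth_kneading_word)
  finally show "left_word (\<lambda>i. P (k + i)) n ! i = kneading_word s 3 n ! i" .
qed

lemma tail_expand:
  assumes "x \<in> core s" "\<And>i. i < j \<Longrightarrow> x (Suc (m + i)) \<in> side (P (m + i))"
  shows "x m - p m = (-1) ^ ones (left_word (\<lambda>i. P (m + i)) j) * s ^ j * (x (m + j) - p (m + j))"
proof -
  have "follows s (x (m + j)) (left_word (\<lambda>i. P (m + i)) j)"
    using assms by (intro follows_left_word)
  moreover have "follows s (p (m + j)) (left_word (\<lambda>i. P (m + i)) j)"
    using p_core p_side by (intro follows_left_word)
  ultimately show ?thesis
    using follows_expand[of s "x (m + j)" "left_word (\<lambda>i. P (m + i)) j" "p (m + j)"] s_gt_1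
      core_iter[OF assms(1)] core_iter[OF p_core] by simp
qed

text \<open>Only a tail equal to that of \<open>P\<close> is required, so that the neighbours of
  \<open>P\<close> are covered too. Their height signs differ from those of \<open>P\<close> by a
  constant factor, and deviations are possible both at folds and one level after them.\<close>

lemma not_extremum:
  assumes tail: "\<And>j. m \<le> j \<Longrightarrow> u j = P j"
  shows "\<not> cylinder_extremum s L u"
proof (cases "left_adm_core s u")
  case False
  then show ?thesis by (auto simp: cylinder_extremum_def cylinder_def)
next
  case True
  then obtain x where x: "x \<in> core s" "\<And>i. x (Suc i) \<in> side (u i)"
    using left_adm_core_realized by blast
  have xP: "x (Suc (i + j)) \<in> side (P (i + j))" if "m \<le> i" for i j
    using x(2)[of "i + j"] tail[of "i + j"] that by simp
  define C where "C = height_sign L u m * height_sign L P m"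
  have C: "C = 1 \<or> C = -1"
    using height_sign_cases[of L u m] height_sign_cases[of L P m] by (auto simp: C_def)
  have sign: "height_sign L u k = C * height_sign L P k" if "m \<le> k" for k
    using that
  proof (induction k rule: dec_induct)
    case base
    then show ?case using height_sign_cases[of L P m] by (auto simp: C_def)
  next
    case (step k)
    then show ?case using tail[of "Suc k"] by (simp add: height_sign_Suc)
  qed
  \<comment> \<open>A period has an odd number of ones, so \<open>x K\<close> and
    \<open>x (K + n)\<close> cannot both lie strictly below \<open>cr 3\<close>.\<close>
  have fold: "\<exists>k\<ge>i. m \<le> k \<and> k mod n = k0 \<and> cr 3 \<le> x k" for i
  proof -
    define K where "K = k0 + (i + m) * n"
    have "(i + m) * 1 \<le> (i + m) * n" using n_ge_1 by (intro mult_le_mono) auto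
    then have "i + m \<le> K" unfolding K_def mult_1_right by (rule trans_le_add2)
    moreover have "K mod n = k0" using k0_less by (simp add: K_def)
    ultimately have K: "i + m \<le> K" "K mod n = k0" .
    have "x K - p K = - (s ^ n * (x (K + n) - p (K + n)))"
      using tail_expand[OF x(1) xP, where m = K and j = n] K(1) fold_word[OF K(2)] k_odd by (simp add: uminus_power_if)
    moreover have "p K = cr 3" "p (K + n) = cr 3" using p_at_fold(1) K(2) by auto
    ultimately have "x K - cr 3 = s ^ n * (cr 3 - x (K + n))" by (simp add: algebra_simps)
    then have "cr 3 \<le> x K \<or> cr 3 \<le> x (K + n)"
      using s_gt_1 by (smt (verit) mult_nonneg_nonneg zero_le_power)
    then show ?thesis
    proof
      assume "cr 3 \<le> x K"
      then show ?thesis using K by (intro exI[of _ K]) simp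
    next
      assume "cr 3 \<le> x (K + n)"
      then show ?thesis using K by (intro exI[of _ "K + n"]) simp
    qed
  qed
  have after: "\<exists>k\<ge>i. m \<le> k \<and> k mod n = (k0 + 1) mod n \<and> cr 3 \<le> x k" for i
  proof -
    \<comment> \<open>The gap between \<open>p K = 1 - cr 2\<close> and \<open>cr 3\<close>.
      Expansion forces \<open>x K\<close> within \<open>d\<close> of \<open>p K\<close> at
      sufficiently deep levels.\<close>
    define d where "d = 1 - cr 2 - cr 3"
    have d: "0 < d" using cr2_cr3 by (simp add: d_def)
    obtain j where j: "1 / d < s ^ j" using real_arch_pow[OF s_gt_1] by blast
    define K where "K = (k0 + 1) + (i + m + j) * n"
    have "(i + m + j) * 1 \<le> (i + m + j) * n" using n_ge_1 by (intro mult_le_mono) auto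
    then have "i + m + j \<le> K" unfolding K_def mult_1_right by (rule trans_le_add2)
    moreover have "K mod n = (k0 + 1) mod n" unfolding K_def by (rule mod_mult_self1)
    ultimately have K: "i + m + j \<le> K" "K mod n = (k0 + 1) mod n" .
    have "x m - p m = (-1) ^ ones (left_word (\<lambda>i. P (m + i)) (K - m)) * s ^ (K - m) * (x K - p K)"
      using tail_expand[OF x(1) xP, where m = m and j = "K - m"] K(1) by simp
    then have "\<bar>x m - p m\<bar> = s ^ (K - m) * \<bar>x K - p K\<bar>"
      using s_gt_1 by (simp add: abs_mult power_abs)
    moreover have "\<bar>x m - p m\<bar> \<le> 1"
      using core_unit[OF core_mem[OF x(1), of m]] core_unit[OF core_mem[OF p_core, of m]] by auto
    moreover have "s ^ j * \<bar>x K - p K\<bar> \<le> s ^ (K - m) * \<bar>x K - p K\<bar>"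
      using s_gt_1 K(1) by (intro mult_right_mono power_increasing) auto
    ultimately have le: "s ^ j * \<bar>x K - p K\<bar> \<le> 1" by linarith
    have "\<bar>x K - p K\<bar> \<le> d"
    proof (rule ccontr)
      assume "\<not> \<bar>x K - p K\<bar> \<le> d"
      then have "s ^ j * d \<le> s ^ j * \<bar>x K - p K\<bar>" using s_gt_1 by (intro mult_left_mono) auto
      moreover have "1 < s ^ j * d" using j d by (simp add: field_simps)
      ultimately show False using le by linarith
    qed
    moreover have "p K = 1 - cr 2" using p_after_fold(1)[OF K(2)] cr_n2 by simp
    ultimately have "cr 3 \<le> x K" unfolding d_def by linarith
    then show ?thesis using K by (intro exI[of _ K]) simp
  qed
  have ne: "k0 \<noteq> (k0 + 1) mod n" using k0_less n_ge_2 by (simp add: mod_Suc)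
  show ?thesis
  proof (rule not_cylinder_extremum)
    fix i :: nat and e :: real assume "e \<in> {1, -1}"
    then have "e = C * - sgm \<or> e = C * sgm" using C sgm_cases by auto
    then have "\<exists>k\<ge>i. m \<le> k \<and> cr 3 \<le> x k \<and> height_sign L P k = C * e"
    proof
      assume "e = C * - sgm"
      moreover obtain k where k: "i \<le> k" "m \<le> k" "k mod n = k0" "cr 3 \<le> x k"
        using fold by blast
      ultimately have "height_sign L P k = C * e" using C height_sign_P[of k] by auto
      then show ?thesis using k by blast
    next
      assume "e = C * sgm"
      moreover obtain k where k: "i \<le> k" "m \<le> k" "k mod n = (k0 + 1) mod n" "cr 3 \<le> x k"
        using after by blast
      have "height_sign L P k = sgm" using height_sign_P[of k] k(3) ne by presburger
      ultimately have "height_sign L P k = C * e" using C by auto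
      then show ?thesis using k by blast
    qed
    then obtain k where k: "i \<le> k" "m \<le> k" "cr 3 \<le> x k" "height_sign L P k = C * e" by blast
    have "height_sign L u k = e" using sign[OF k(2)] k(4) C by auto
    then show "\<exists>k\<ge>i. height_sign L u k = e \<and> (\<exists>v. left_adm_core s v \<and> agree k u v \<and> u k \<noteq> v k)"
      using deviation_exists[OF x k(3)] k(1) by metis
  qed
qed

section \<open>Position of deviating arcs relative to the folding point\<close>

definition orient :: "nat \<Rightarrow> real" where
  "orient k = (-1) ^ ones (left_word P k)"

lemma orient_cases: "orient k = 1 \<or> orient k = -1"
  by (cases "even (ones (left_word P k))") (auto simp: orient_def)

lemma orient_period: "k mod n = k0 \<Longrightarrow> orient (k + n) = - orient k"
  using k_odd by (simp add: orient_def left_word_add fold_word power_add)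

lemma orient_eq: "orient (k0 + i * n) = orient k0 * (-1) ^ i"
proof (induction i)
  case (Suc i)
  have "k0 + Suc i * n = (k0 + i * n) + n" by simp
  then show ?case using orient_period[of "k0 + i * n"] k0_less Suc by (simp only:) simp
qed simp

text \<open>The first difference contributes \<open>- 2 * height_sign L P k / 3 ^ Suc k\<close>, and
  all later digits together at most half of that in size. At a fold \<open>height_sign L P k\<close>
  is \<open>- sgm\<close>.\<close>

lemma height_deviation:
  assumes "agree k P v" "P k \<noteq> v k"
  shows "k mod n = k0 \<Longrightarrow> sgm * (psi L v - psi L P) \<in> {1 / 3 ^ Suc k..3 / 3 ^ Suc k}"
    and "k mod n \<noteq> k0 \<Longrightarrow> sgm * (psi L v - psi L P) < 0"
proof -
  define t where "t = (1 / 3 ^ Suc k :: real)"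
  have t: "0 < t" "3 / 3 ^ Suc k = 3 * t" "1 / 3 ^ Suc k = t" by (auto simp: t_def)
  have "\<bar>psi L v - psi L P + 2 * height_sign L P k * t\<bar> \<le> t"
    using psi_first_difference[OF assms, of L] by (simp add: t_def)
  then show "k mod n = k0 \<Longrightarrow> sgm * (psi L v - psi L P) \<in> {1 / 3 ^ Suc k..3 / 3 ^ Suc k}"
    "k mod n \<noteq> k0 \<Longrightarrow> sgm * (psi L v - psi L P) < 0"
    unfolding t(2,3) using t(1) sgm_cases by (auto simp: height_sign_P abs_le_iff)
qed

text \<open>Points leaving the itinerary of \<open>p\<close> at a fold have passed \<open>cr 3\<close> on its right, the
  only side allowed by the core, and so they stay on one side of \<open>p\<close>.\<close>

lemma side_deviation:
  assumes x: "x \<in> core s" "\<And>i. x (Suc i) \<in> side (v i)"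
    and v: "agree k P v" "P k \<noteq> v k" "k mod n = k0"
  shows "0 \<le> orient k * (x 0 - p 0)"
proof -
  have "\<not> v k" using p_at_fold(2)[OF v(3)] v(2) by simp
  then have "x k = s * x (Suc k)"
    using tent_side[of s "x (Suc k)" False] x(2)[of k] core_tent[OF x(1), of k] s_gt_1 by simp
  moreover have "s * cr 2 \<le> s * x (Suc k)"
    using core_mem[OF x(1), of "Suc k"] s_gt_1 by (intro mult_left_mono) auto
  ultimately have ge: "0 \<le> x k - p k" using p_at_fold(1)[OF v(3)] cr3 by simp
  have "x (Suc (0 + i)) \<in> side (P (0 + i))" if "i < k" for i
    using x(2)[of i] v(1) that by (simp add: agree_def)
  then have "x 0 - p 0 = orient k * s ^ k * (x k - p k)"
    using tail_expand[OF x(1), where m = 0 and j = k] by (simp add: orient_def)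
  then have "orient k * (x 0 - p 0) = (orient k * orient k) * (s ^ k * (x k - p k))" by simp
  also have "orient k * orient k = 1" using orient_cases[of k] by auto
  finally show ?thesis using ge s_gt_1 by simp
qed

end

section \<open>The zigzag curve\<close>

lemma cos_minus_npi: "cos (t - real i * pi) = (-1) ^ i * cos t"
  by (simp add: cos_diff)

lemma log_3_bounds:
  assumes "r \<in> {1 / 3 ^ Suc k..3 / 3 ^ Suc k}"
  shows "- real (Suc k) \<le> log 3 r" "log 3 r \<le> - real k"
proof -
  have r: "0 < r" using assms by (smt (verit) atLeastAtMost_iff zero_less_divide_1_iff zero_less_power)
  have "log 3 (1 / 3 ^ Suc k) \<le> log 3 r"
    using assms r by (intro log_mono) auto
  then show "- real (Suc k) \<le> log 3 r" by (simp add: log_divide log_nat_power del: power_Suc)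
  have "log 3 r \<le> log 3 (1 / 3 ^ k)"
    using assms r by (intro log_mono) auto
  then show "log 3 r \<le> - real k" by (simp add: log_divide log_nat_power)
qed

context periodic_point
begin

text \<open>The curve approaches \<open>p\<close> through the heights \<open>psi L P + sgm * r\<close>, \<open>r \<rightarrow> 0\<close>. At the
  heights of the arcs that turn at \<open>p\<close>, near \<open>r = 3 ^ (- k)\<close> with \<open>k mod n = k0\<close>, these arcs lie
  alternately on either side of \<open>p\<close>; the cosine makes the curve swing to the free side.\<close>

definition curve :: "real \<Rightarrow> real" where
  "curve r = p 0 - orient k0 * r * cos (pi * (log 3 r + real k0 + 1/2) / real n)"

lemma curve_near: "0 \<le> r \<Longrightarrow> \<bar>curve r - p 0\<bar> \<le> r"
  using orient_cases[of k0] abs_cos_le_one[of "pi * (log 3 r + real k0 + 1/2) / real n"]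
  by (auto simp: curve_def abs_mult mult_left_le)

text \<open>Each further fold shifts the phase by \<open>pi\<close>, matching the alternation of
  \<open>orient\<close>. The quantitative margin will exceed the radius of any semicircle met in
  this height band.\<close>

lemma curve_at_fold:
  assumes k: "k mod n = k0" and r: "r \<in> {1 / 3 ^ Suc k..3 / 3 ^ Suc k}"
  shows "orient k * (curve r - p 0) < - (1 / 3 ^ Suc k) / 2"
proof -
  define i where "i = k div n"
  have ki: "k = k0 + i * n" using k by (metis add.commute div_mult_mod_eq i_def)
  define t where "t = pi * (log 3 r + real k + 1/2) / real n"
  have n: "2 \<le> real n" using n_ge_2 by simp
  \<comment> \<open>The summand \<open>1/2\<close> centres the logarithmic band. With
    \<open>n\<close> at least 2 the phase is at most \<open>pi / 4\<close>, so the cosine exceeds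
    \<open>1/2\<close>.\<close>
  have "\<bar>log 3 r + real k + 1/2\<bar> \<le> 1/2" using log_3_bounds[OF r] unfolding abs_le_iff by auto
  then have "\<bar>t\<bar> \<le> pi * (1/2) / 2"
    unfolding t_def abs_mult abs_divide using n by (intro frac_le mult_mono) auto
  then have "\<bar>t\<bar> < pi / 3" using pi_gt_zero by linarith
  then have "cos (pi / 3) < cos \<bar>t\<bar>" using pi_gt_zero by (intro cos_monotone_0_pi) auto
  then have c: "1/2 < cos t" by (simp add: cos_60)
  have "pi * (log 3 r + real k0 + 1/2) / real n = t - real i * pi"
    using n unfolding t_def ki by (simp add: field_simps)
  then have "curve r - p 0 = - (orient k0 * (-1) ^ i) * r * cos t"
    by (simp add: curve_def cos_minus_npi)
  also have "orient k0 * (-1) ^ i = orient k" using orient_eq[of i] ki by simp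
  finally have "orient k * (curve r - p 0) = - (orient k * orient k) * (r * cos t)" by simp
  also have "orient k * orient k = 1" using orient_cases[of k] by auto
  finally have "orient k * (curve r - p 0) = - (r * cos t)" by simp
  moreover have "0 < r" using r by (smt (verit) atLeastAtMost_iff zero_less_divide_1_iff zero_less_power)
  then have "r * (1/2) < r * cos t" using c by (intro mult_strict_left_mono) auto
  moreover have "(1 / 3 ^ Suc k) / 2 \<le> r * (1/2)" using r by simp
  ultimately show ?thesis by linarith
qed

lemma continuous_on_curve: "continuous_on {0..} curve"
  unfolding continuous_on_def
proof
  fix r :: real assume r: "r \<in> {0..}"
  show "(curve \<longlongrightarrow> curve r) (at r within {0..})"
  proof (cases "r = 0")
    case True
    \<comment> \<open>At \<open>0\<close> the oscillation of the logarithm is damped by the factor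
      \<open>r\<close>.\<close>
    have "((\<lambda>x. curve x - p 0) \<longlongrightarrow> 0) (at 0 within {0..})"
    proof (rule Lim_null_comparison)
      show "\<forall>\<^sub>F x in at 0 within {0..}. norm (curve x - p 0) \<le> x"
        using curve_near by (auto simp: eventually_at intro!: exI[of _ 1])
      show "((\<lambda>x :: real. x) \<longlongrightarrow> 0) (at 0 within {0..})"
        by (rule tendsto_ident_at)
    qed
    then show ?thesis using True by (simp add: curve_def LIM_zero_cancel LIM_zero_iff)
  next
    case False
    then have "isCont curve r"
      using r n_ge_1 unfolding curve_def by (intro continuous_intros) auto
    then show ?thesis by (auto simp: isCont_def intro: tendsto_within_subset)
  qed
qed

section \<open>Access to the folding point along the curve\<close>

definition itin :: "int \<Rightarrow> bool" where
  "itin i \<longleftrightarrow> 1/2 \<le> coord s p i"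

lemma left_part_itin: "left_part itin = P"
proof
  fix j
  have "nat (- (- int (Suc j))) = Suc j" by simp
  then show "left_part itin j = P j" by (simp add: left_part_def itin_def P_def coord_def)
qed

lemma itinerary_itin: "itinerary s p itin"
proof -
  have side: "coord s p i \<in> side (itin i)" for i
    using side_cases[OF core_unit[OF coord_core[OF p_core]]] by (simp add: itin_def)
  have "adm_word s (map itin [i..j])" for i j
    using adm_word_follows[OF coord_core[OF p_core] follows_coord[OF p_core side]] .
  then show ?thesis using side by (simp add: itinerary_def two_sided_adm_def side_def)
qed

lemma itinerary_side:
  assumes "itinerary s x t"
  shows "x (Suc i) \<in> side (left_part t i)"
proof -
  have "coord s x (- int (Suc i)) \<in> side (t (- int (Suc i)))"
    using assms by (simp add: itinerary_def side_def)
  moreover have "nat (- (- int (Suc i))) = Suc i" by simp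
  ultimately show ?thesis by (simp add: coord_def left_part_def)
qed

lemma p_less_cr1: "p i < cr 1"
proof -
  obtain j where "3 \<le> j" "p i = cr j" using p_orbit by auto
  then have "p i \<noteq> cr 1" using cr_1_notin[of j] by simp
  then show ?thesis using core_mem[OF p_core, of i] by (simp add: less_le)
qed

text \<open>Positive \<open>r\<close> lies on the vertical side reserved for fold deviations. Such
  an arc and the curve are on opposite horizontal sides of \<open>p\<close> at that height.\<close>

lemma avoid_arc:
  assumes x: "x \<in> core s" "itinerary s x t" and r: "0 < r"
  shows "(curve r, psi L P + sgm * r) \<noteq> (x 0, psi L (left_part t))"
proof
  assume eq: "(curve r, psi L P + sgm * r) = (x 0, psi L (left_part t))"
  have rr: "sgm * (psi L (left_part t) - psi L P) = r"
    using eq sgm_cases by auto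
  have "left_part t \<noteq> P" using rr r by auto
  then obtain j where "left_part t j \<noteq> P j" by blast
  then have "\<not> agree (Suc j) P (left_part t)" by (auto simp: agree_def)
  then obtain k where k: "agree k P (left_part t)" "P k \<noteq> left_part t k"
    by (rule first_difference)
  have fold: "k mod n = k0" using height_deviation(2)[OF k] rr r by fastforce
  have band: "r \<in> {1 / 3 ^ Suc k..3 / 3 ^ Suc k}" using height_deviation(1)[OF k fold] rr by simp
  have "0 \<le> orient k * (curve r - p 0)"
    using side_deviation[OF x(1) itinerary_side[OF x(2)] k fold] eq by simp
  moreover have "0 < (1 / 3 ^ Suc k :: real) / 2" by simp
  ultimately show False using curve_at_fold[OF fold band] by linarith
qed

text \<open>Either the semicircle turns away from \<open>p\<close> at a distance larger than the
  reach of the curve, or both its ends leave \<open>P\<close> at the same fold and its radius is too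
  small to bridge the gap.\<close>

lemma avoid_semicircle:
  assumes x: "x \<in> core s" "itinerary s x t" "itinerary s x u" and k: "k < 0" "identified_at s k t u"
    and r: "0 < r" "\<And>j. cr j \<noteq> p 0 \<Longrightarrow> r < \<bar>cr j - p 0\<bar>"
  shows "(curve r, psi L P + sgm * r) \<notin>
    semicircle (odd (ones (map t [k + 1..-1]))) (x 0) (psi L (left_part t)) (psi L (left_part u))"
proof
  let ?T = "left_part t" and ?U = "left_part u"
  assume q: "(curve r, psi L P + sgm * r) \<in>
    semicircle (odd (ones (map t [k + 1..-1]))) (x 0) (psi L ?T) (psi L ?U)"
  let ?c = "(x 0, (psi L ?T + psi L ?U) / 2)"
  have d: "dist (curve r, psi L P + sgm * r) ?c = \<bar>psi L ?T - psi L ?U\<bar> / 2"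
    using q by (simp add: semicircle_def)
  have dx: "\<bar>curve r - x 0\<bar> \<le> \<bar>psi L ?T - psi L ?U\<bar> / 2"
    using dist_fst_le[of "(curve r, psi L P + sgm * r)" ?c] d by (simp add: dist_real_def)
  have dy: "\<bar>psi L P + sgm * r - (psi L ?T + psi L ?U) / 2\<bar> \<le> \<bar>psi L ?T - psi L ?U\<bar> / 2"
    using dist_snd_le[of "(curve r, psi L P + sgm * r)" ?c] d by (simp add: dist_real_def)
  define m where "m = nat (- k - 1)"
  have km: "k = - int (Suc m)" using k(1) by (simp add: m_def)
  have TU: "agree m ?T ?U" "?T m \<noteq> ?U m"
    using k(2) unfolding identified_at_def km by (auto simp: agree_def left_part_def)
  have word: "map t [k + 1..-1] = left_word ?T m"
  proof (rule nth_equalityI)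
    fix i assume "i < length (map t [k + 1..-1])"
    then have i: "i < m" by (simp add: km)
    have "map t [k + 1..-1] ! i = t (k + 1 + int i)" using i by (simp add: km nth_upto)
    also have "k + 1 + int i = - int (Suc (m - Suc i))" using i by (simp add: km)
    also have "t \<dots> = left_word ?T m ! i" using i by (simp add: left_word_def rev_nth left_part_def)
    finally show "map t [k + 1..-1] ! i = left_word ?T m ! i" .
  qed (simp add: km)
  \<comment> \<open>This coordinate admits both digits.\<close>
  have "x (Suc m) = 1/2"
    using itinerary_side[OF x(2), of m] itinerary_side[OF x(3), of m] TU(2)
    by (auto simp: side_def split: if_splits)
  then have "x m = tent s (1/2)" using core_tent[OF x(1), of m] by metis
  then have xm: "x m = cr 1" by simp
  have x0: "x 0 = cr (Suc m)"
    using core_iter[OF x(1), of m 0] cr_add[of m 1] xm by simp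
  show False
  proof (cases "agree m P ?T")
    \<comment> \<open>The arcs end at \<open>x m = cr 1\<close>, which is beyond \<open>p m\<close>.
      At depth 0 the endpoint thus lies in direction \<open>orient m\<close> from \<open>p\<close>,
      and the semicircle bulges further in that direction.\<close>
    case True
    have "x (Suc (0 + i)) \<in> side (P (0 + i))" if "i < m" for i
      using itinerary_side[OF x(2), of i] True that by (simp add: agree_def)
    then have "x 0 - p 0 = orient m * s ^ m * (cr 1 - p m)"
      using tail_expand[OF x(1), where m = 0 and j = m] xm by (simp add: orient_def)
    moreover have "0 < s ^ m * (cr 1 - p m)" using p_less_cr1[of m] s_gt_1 by simp
    ultimately have side: "0 < orient m * (x 0 - p 0)" using orient_cases[of m] by auto
    then have "r < \<bar>x 0 - p 0\<bar>" using r(2)[of "Suc m"] x0 by force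
    moreover have "orient m = (if odd (ones (map t [k + 1..-1])) then - 1 else 1)"
      unfolding word orient_def using left_word_agree[OF True] by simp
    then have "0 \<le> orient m * (curve r - x 0)"
      using q by (auto simp: semicircle_def)
    moreover have "\<bar>curve r - p 0\<bar> \<le> r" using curve_near r(1) by simp
    ultimately show False using side orient_cases[of m] by auto
  next
    case False
    then obtain l where l: "l < m" "agree l P ?T" "P l \<noteq> ?T l" by (rule first_difference)
    have lU: "agree l P ?U" "P l \<noteq> ?U l"
      using l TU(1) by (auto simp: agree_def)
    let ?t = "sgm * (psi L ?T - psi L P)" and ?u = "sgm * (psi L ?U - psi L P)"
    \<comment> \<open>The height of a point on the semicircle is between those of its ends, so both
      inherit the same fold band.\<close>
    have between: "min ?t ?u \<le> r" "r \<le> max ?t ?u"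
      using dy sgm_cases by (auto simp: min_def max_def abs_if field_simps split: if_splits)
    have fold: "l mod n = k0"
      using height_deviation(2)[OF l(2,3)] height_deviation(2)[OF lU] between(2) r(1)
      by (cases "l mod n = k0") (auto simp: max_def split: if_splits)
    have band: "r \<in> {1 / 3 ^ Suc l..3 / 3 ^ Suc l}"
      using height_deviation(1)[OF l(2,3) fold] height_deviation(1)[OF lU fold] between
      by (auto simp: min_def max_def split: if_splits)
    have le: "\<bar>psi L ?T - psi L ?U\<bar> \<le> 1 / 3 ^ Suc l"
      using psi_agree[OF agree_sym[OF agree_mono[OF TU(1)]], of "Suc l" L] l(1) by simp
    have "\<bar>curve r - x 0\<bar> \<le> (1 / 3 ^ Suc l) / 2"
      by (rule order_trans[OF dx divide_right_mono[OF le]]) simp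
    then have "\<bar>orient l * (curve r - p 0) - orient l * (x 0 - p 0)\<bar> \<le> (1 / 3 ^ Suc l) / 2"
      using orient_cases[of l] by auto
    moreover have "0 \<le> orient l * (x 0 - p 0)"
      using side_deviation[OF x(1) itinerary_side[OF x(2)] l(2,3) fold] .
    ultimately show False using curve_at_fold[OF fold band] by linarith
  qed
qed

lemma accessible_p: "accessible (core_image s L) (p 0, psi L P)"
proof -
  \<comment> \<open>The positive distance from \<open>p 0\<close> to the other points of the finite
    critical orbit; ends of semicircles are such points or \<open>p 0\<close> itself.\<close>
  obtain d where d: "0 < d" "\<And>j. cr j \<noteq> p 0 \<Longrightarrow> d \<le> dist (p 0) (cr j)"
    using finite_set_avoid[OF finite_critical_orbit, of "p 0"] by auto
  define g where "g t = (curve (d / 2 * t), psi L P + sgm * (d / 2 * t))" for t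
  have g0: "g 0 = (p 0, psi L P)" by (simp add: g_def curve_def)
  have "arc g"
    unfolding arc_def path_def
  proof
    show "continuous_on {0..1} g"
      unfolding g_def using d(1)
      by (intro continuous_intros continuous_on_compose2[OF continuous_on_curve]) auto
    show "inj_on g {0..1}"
      using d(1) sgm_cases by (auto simp: inj_on_def g_def)
  qed
  moreover have "path_image g \<inter> core_image s L = {(p 0, psi L P)}"
  proof
    have "(p 0, psi L P) \<in> draw s L p"
      unfolding draw_def using itinerary_itin left_part_itin by force
    then have "(p 0, psi L P) \<in> core_image s L"
      using p_core by (auto simp: core_image_def)
    then show "{(p 0, psi L P)} \<subseteq> path_image g \<inter> core_image s L"
      using g0 by (auto simp: path_image_def intro!: image_eqI[of _ g 0])
    show "path_image g \<inter> core_image s L \<subseteq> {(p 0, psi L P)}"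
    proof
      fix a assume "a \<in> path_image g \<inter> core_image s L"
      then obtain t x where t: "t \<in> {0..1}" "a = g t" and x: "x \<in> core s" "g t \<in> draw s L x"
        by (auto simp: path_image_def core_image_def)
      have "t = 0"
      proof (rule ccontr)
        assume "t \<noteq> 0"
        then have r: "0 < d / 2 * t" "d / 2 * t < d" using t(1) d(1)
          by (auto intro: le_less_trans[of _ "d / 2 * 1"])
        have r2: "d / 2 * t < \<bar>cr j - p 0\<bar>" if "cr j \<noteq> p 0" for j
          using d(2)[OF that] r(2) by (simp add: dist_real_def abs_minus_commute)
        show False
          using x(2) avoid_arc[OF x(1) _ r(1)] avoid_semicircle[OF x(1) _ _ _ _ r(1) r2]
          unfolding draw_def g_def by blast
      qed
      then show "a \<in> {(p 0, psi L P)}" using t(2) g0 by simp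
    qed
  qed
  ultimately show ?thesis unfolding accessible_def by blast
qed

lemma type3_p:
  assumes "folding_point s p"
  shows "type3 s L p"
  unfolding type3_def
proof (intro conjI bexI exI ballI)
  show "accessible (core_image s L) (p 0, psi L P)" by (rule accessible_p)
  show "(p 0, psi L P) \<in> draw s L p"
    unfolding draw_def using itinerary_itin left_part_itin by force
  show "itinerary s p itin" by (rule itinerary_itin)
  fix u assume "u \<in> {left_part itin} \<union> right_nbr s (left_part itin) \<union> left_nbr s (left_part itin)"
  then have "u = P \<or> (\<exists>j. u = P(j := \<not> P j))"
    unfolding left_part_itin right_nbr_def left_nbr_def by blast
  then show "\<not> cylinder_extremum s L u"
  proof
    assume "\<exists>j. u = P(j := \<not> P j)"
    then obtain j where "u = P(j := \<not> P j)" by blast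
    then show ?thesis by (intro not_extremum[of "Suc j"]) auto
  qed (use not_extremum[of 0] in simp)
qed (rule assms)

text \<open>The cycle has digits 1 at arbitrary depth, which rules out the ray cases of
  \<open>left_adm\<close>. Admissibility of its finite subwords then passes to the shift
  \<open>L\<close>.\<close>

lemma left_adm_L:
  assumes "left_adm s (left_cycle ([True, False] @ kneading_word s 3 (n - 2)))"
  shows "left_adm s L"
proof -
  let ?C = "left_cycle ([True, False] @ kneading_word s 3 (n - 2))"
  have C: "?C (n - 1 + i * n)" for i
  proof -
    have "(n - 1 + i * n) mod n = n - 1"
      unfolding mod_mult_self1 using n_ge_1 by simp
    then show ?thesis unfolding left_cycle_eq by presburger
  qed
  have beyond: "k < n - 1 + Suc k * n" for k
  proof -
    have "Suc k \<le> Suc k * n" using mult_le_mono2[OF n_ge_1, of "Suc k"] unfolding mult_1_right .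
    then show ?thesis by (intro Suc_le_lessD trans_le_add2)
  qed
  have "left_adm_core s ?C"
    using assms C[of 0] C[of "Suc k" for k] beyond unfolding left_adm_def by metis
  then have "adm_word s (map ?C (rev [i..<j]))" for i j
    by (simp add: left_adm_core_def)
  moreover have "map L (rev [i..<j]) = map ?C (rev [i + (2 * n - 2 - k0)..<j + (2 * n - 2 - k0)])" for i j
    by (rule nth_equalityI) (simp_all add: L_def rev_nth algebra_simps)
  ultimately have "left_adm_core s L" by (simp add: left_adm_core_def)
  then show ?thesis by (simp add: left_adm_def)
qed

end

theorem lemma9p25:
  fixes s :: real and n :: nat
  assumes "sqrt 2 < s" and "s \<le> 2" and "n \<ge> 1"
    and "kneading s 1" and "\<not> kneading s 2"
    and "\<forall>i\<ge>3. kneading s (i + n) = kneading s i"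
    and "odd (ones (kneading_word s 3 n))"
    and "kneading s (n + 2)"
    and "\<not> kneading s (n + 1)"
    and "left_adm s (left_cycle ([True, False] @ kneading_word s 3 (n - 2)))"
  shows "\<forall>p. folding_point s p \<longrightarrow> (\<exists>L. left_adm s L \<and> type3 s L p)"
proof (intro allI impI)
  interpret tent_kneading s n
    using assms by unfold_locales auto
  fix p assume p: "folding_point s p"
  obtain j where j: "3 \<le> j" "p 0 = cr j" using folding_point_coords[OF p, of 0] by auto
  \<comment> \<open>Reducing the index modulo the period supplies the phase \<open>k0 < n\<close> of
    the locale.\<close>
  have "cr j = cr ((j - 3) mod n + 3)"
  proof (rule cr_mod_eq)
    have "((j - 3) mod n + 3) mod n = (j - 3 + 3) mod n" by (rule mod_add_left_eq)
    then show "j mod n = ((j - 3) mod n + 3) mod n" using j(1) by simp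
  qed (use j in auto)
  then interpret periodic_point s n p "(j - 3) mod n"
    using p j folding_point_coords[OF p] assms(3)
    by unfold_locales (auto simp: folding_point_def)
  show "\<exists>L. left_adm s L \<and> type3 s L p"
    using left_adm_L[OF assms(10)] type3_p[OF p] by blast
qed

end
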